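(* Assume condition (A) holds for some $\ell\in\mathbb R$ and let $U$ be a Gaussian noise with spectral measure $\mu$. Then for any $p\in[1,\infty)$, $\kappa>\frac{3d}{p}$ and $\beta<\frac\ell2-\frac{4d}p$, $U$ (viewed as a random distribution on $\mathbb R^{2d}$ via $\mathcal R_jU(z):=U(\tau_z\check\phi_j)$) satisfies $\mathbf E\big(\|U\|^p_{\mathbf C^\beta_a(\rho_\kappa)}\big)<\infty$, i.e. $U\in L^p(\Omega;\mathbf C^\beta_a(\rho_\kappa;\mathbb R))$.
   Context: Fix $d\ge2$; $z=(x,v)\in\mathbb R^{2d}$, $|z|_a:=|x|^{1/3}+|v|$, $B^a_r:=\{|z|_a\le r\}$, $\rho_\kappa(z):=((1+|x|^2)^{1/3}+1+|v|^2)^{-\kappa/2}$, $2^{sa}\xi:=(2^{3s}\xi_1,2^s\xi_2)$. Let $\chi_0$ be symmetric smooth, $=1$ on $B^a_1$, $=0$ outside $B^a_{4/3}$; $\phi_0:=\chi_0$, $\phi_j(\xi):=\chi_0(2^{-ja}\xi)-\chi_0(2^{-(j-1)a}\xi)$ ($j\ge1$); $\check\phi_j:=\mathcal F^{-1}\phi_j$, $\mathcal R_jf:=\check\phi_j*f$; for $\beta\notin\mathbb N_0$, $\|f\|_{\mathbf C^\beta_a(\rho_\kappa)}:=\sup_{j\ge0}2^{j\beta}\|\rho_\kappa\mathcal R_jf\|_{L^\infty}$. Condition (A): $\mu$ is a signed Radon measure on $\mathbb R^{2d}=\{\zeta=(\xi,\eta)\}$, symmetric in the sense $\mu(d\xi,d\eta)=\mu(-d\xi,d\eta)=\mu(d\xi,-d\eta)$,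 with $\int(1+|\zeta|_a)^\ell|\mu|(d\zeta)<\infty$ ($|\mu|$ the total variation), and such that $\langle f,g\rangle_{\mathbb H}:=\int\hat f(\zeta)\overline{\hat g(\zeta)}\mu(d\zeta)$ is positive semidefinite on Schwartz functions; $\mathbb H$ is the completion of real Schwartz functions under it. A Gaussian noise with spectral measure $\mu$ is a continuous linear map $U:\mathbb H\to L^2(\Omega,\mathbf P)$ such that each $U(f)$ is a centered real Gaussian variable and $\mathbf E(U(f)U(g))=\langle f,g\rangle_{\mathbb H}$. For $\varphi\in\mathbb H$, $\tau_z\varphi:=\varphi(\cdot-z)$, and $z\mapsto U(\tau_z\varphi)$ is taken in its smooth version. *)

theory Defs
  imports "HOL-Analysis.Analysis" "HOL-Probability.Characteristic_Functions"
begin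

type_synonym 'n ph = "(real^'n) \<times> (real^'n)"

fun iter_dderiv :: "'n ph list \<Rightarrow> ('n::finite ph \<Rightarrow> real) \<Rightarrow> 'n ph \<Rightarrow> real" where
  "iter_dderiv [] f = f"
| "iter_dderiv (v # vs) f = (\<lambda>z. frechet_derivative (iter_dderiv vs f) (at z) v)"

definition smooth_fun :: "('n::finite ph \<Rightarrow> real) \<Rightarrow> bool" where
  "smooth_fun f \<longleftrightarrow> (\<forall>vs z. iter_dderiv vs f differentiable (at z))"

definition schwartz :: "('n::finite ph \<Rightarrow> real) \<Rightarrow> bool" where
  "schwartz f \<longleftrightarrow> smooth_fun f \<and>
     (\<forall>vs (k::nat). bounded (range (\<lambda>z. norm z ^ k * iter_dderiv vs f z)))"

definition fourier :: "('n::finite ph \<Rightarrow> real) \<Rightarrow> 'n ph \<Rightarrow> complex" where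
  "fourier f \<xi> = (\<integral>z. complex_of_real (f z) * cis (- (\<xi> \<bullet> z)) \<partial>lborel)"

definition inv_fourier :: "('n::finite ph \<Rightarrow> real) \<Rightarrow> 'n ph \<Rightarrow> complex" where
  "inv_fourier g z = complex_of_real (1 / (2 * pi) ^ (2 * CARD('n))) *
       (\<integral>\<xi>. complex_of_real (g \<xi>) * cis (\<xi> \<bullet> z) \<partial>lborel)"

definition anorm :: "'n::finite ph \<Rightarrow> real" where
  "anorm z = norm (fst z) powr (1/3) + norm (snd z)"

definition rho :: "real \<Rightarrow> 'n::finite ph \<Rightarrow> real" where
  "rho \<kappa> z = ((1 + norm (fst z)^2) powr (1/3) + 1 + norm (snd z)^2) powr (- \<kappa> / 2)"

definition adil :: "real \<Rightarrow> 'n::finite ph \<Rightarrow> 'n ph" where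
  "adil s \<xi> = (2 powr (3 * s) *\<^sub>R fst \<xi>, 2 powr s *\<^sub>R snd \<xi>)"

definition lp_phi :: "('n::finite ph \<Rightarrow> real) \<Rightarrow> nat \<Rightarrow> 'n ph \<Rightarrow> real" where
  "lp_phi ch j \<xi> = (if j = 0 then ch \<xi>
      else ch (adil (- real j) \<xi>) - ch (adil (- (real j - 1)) \<xi>))"

text \<open>check phi_j; it is real-valued since chi_0 is even, so we take the real part.\<close>
definition lp_check :: "('n::finite ph \<Rightarrow> real) \<Rightarrow> nat \<Rightarrow> 'n ph \<Rightarrow> real" where
  "lp_check ch j z = Re (inv_fourier (lp_phi ch j) z)"

definition translate :: "'n::finite ph \<Rightarrow> ('n ph \<Rightarrow> real) \<Rightarrow> 'n ph \<Rightarrow> real" where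
  "translate z \<phi> = (\<lambda>y. \<phi> (y - z))"

definition refl1 :: "'n::finite ph \<Rightarrow> 'n ph" where "refl1 \<zeta> = (- fst \<zeta>, snd \<zeta>)"
definition refl2 :: "'n::finite ph \<Rightarrow> 'n ph" where "refl2 \<zeta> = (fst \<zeta>, - snd \<zeta>)"

text \<open>Condition (A). The signed Radon measure mu is given by its Jordan decomposition
  mu = mup - mun (two mutually singular Borel measures), so |mu| = mup + mun.\<close>
definition sval :: "'n::finite ph measure \<Rightarrow> 'n ph measure \<Rightarrow> 'n ph set \<Rightarrow> real" where
  "sval mup mun A = measure mup A - measure mun A"

definition sinteg :: "'n::finite ph measure \<Rightarrow> 'n ph measure \<Rightarrow> ('n ph \<Rightarrow> complex) \<Rightarrow> complex" where
  "sinteg mup mun h = (\<integral>\<zeta>. h \<zeta> \<partial>mup) - (\<integral>\<zeta>. h \<zeta> \<partial>mun)"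

definition ipH :: "'n::finite ph measure \<Rightarrow> 'n ph measure \<Rightarrow> ('n ph \<Rightarrow> real) \<Rightarrow> ('n ph \<Rightarrow> real) \<Rightarrow> complex" where
  "ipH mup mun f g = sinteg mup mun (\<lambda>\<zeta>. fourier f \<zeta> * cnj (fourier g \<zeta>))"

definition condA :: "real \<Rightarrow> 'n::finite ph measure \<Rightarrow> 'n ph measure \<Rightarrow> bool" where
  "condA ell mup mun \<longleftrightarrow>
     sets mup = sets borel \<and> sets mun = sets borel \<and>
     (\<exists>P\<in>sets borel. emeasure mun P = 0 \<and> emeasure mup (- P) = 0) \<and>
     (\<forall>K. compact K \<longrightarrow> emeasure mup K < \<infinity> \<and> emeasure mun K < \<infinity>) \<and>
     (\<forall>A\<in>sets borel. bounded A \<longrightarrow>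
         sval mup mun (refl1 -` A) = sval mup mun A \<and> sval mup mun (refl2 -` A) = sval mup mun A) \<and>
     (\<integral>\<^sup>+\<zeta>. ennreal ((1 + anorm \<zeta>) powr ell) \<partial>mup) < \<infinity> \<and>
     (\<integral>\<^sup>+\<zeta>. ennreal ((1 + anorm \<zeta>) powr ell) \<partial>mun) < \<infinity> \<and>
     (\<forall>f. schwartz f \<longrightarrow> Re (ipH mup mun f f) \<ge> 0)"

definition centered_gaussian :: "'w measure \<Rightarrow> ('w \<Rightarrow> real) \<Rightarrow> bool" where
  "centered_gaussian M X \<longleftrightarrow> X \<in> borel_measurable M \<and>
     (\<exists>s2\<ge>0. \<forall>t. char (distr M borel X) t = complex_of_real (exp (- s2 * t^2 / 2)))"

definition gaussian_noise :: "'w measure \<Rightarrow> 'n::finite ph measure \<Rightarrow> 'n ph measure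
     \<Rightarrow> (('n ph \<Rightarrow> real) \<Rightarrow> 'w \<Rightarrow> real) \<Rightarrow> bool" where
  "gaussian_noise M mup mun U \<longleftrightarrow> prob_space M \<and>
     (\<forall>f. schwartz f \<longrightarrow> centered_gaussian M (U f)) \<and>
     (\<forall>f g (a::real) b. schwartz f \<longrightarrow> schwartz g \<longrightarrow>
        (AE \<omega> in M. U (\<lambda>z. a * f z + b * g z) \<omega> = a * U f \<omega> + b * U g \<omega>)) \<and>
     (\<forall>f g. schwartz f \<longrightarrow> schwartz g \<longrightarrow>
        complex_of_real (\<integral>\<omega>. U f \<omega> * U g \<omega> \<partial>M) = ipH mup mun f g) \<and>
     (\<forall>f. schwartz f \<longrightarrow> (\<forall>\<omega>\<in>space M. continuous_on UNIV (\<lambda>z. U (translate z f) \<omega>)))"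

definition Cnorm :: "('n::finite ph \<Rightarrow> real) \<Rightarrow> real \<Rightarrow> real \<Rightarrow> (('n ph \<Rightarrow> real) \<Rightarrow> 'w \<Rightarrow> real) \<Rightarrow> 'w \<Rightarrow> ennreal" where
  "Cnorm ch \<beta> \<kappa> U \<omega> = (SUP j::nat. SUP z::'n ph.
      ennreal (2 powr (real j * \<beta>) * rho \<kappa> z * \<bar>U (translate z (lp_check ch j)) \<omega>\<bar>))"

end

(* A Gaussian variable has moments of every order controlled by its variance, so it suffices to bound
  moments of a large even order q: only kappa > 0 and beta < ell/2 matter. By Fourier inversion
  (Gaussian mollification) the transform of the block kernel is phi_j itself, which lives on
  |zeta|_a ~ 2^j; hence the stationary field R_j U has variance O(2^{-j ell}) and increments of
  standard deviation O(2^{-j ell/2} 8^j |z - w|). Dyadic chaining on a lattice of mesh 8^{-j} bounds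
  the q-th moment of its weighted supremum by 2^{-j ell q/2} times a number of lattice points per unit
  volume that is 2^{O(j)} independently of q, and this loss is absorbed, for q large, by the gap
  ell/2 - beta when summing over j. *)
theory Submission
  imports Defs "HOL-Probability.Probability"
begin

section \<open>Even moments of Gaussian variables\<close>

text \<open>The supremum runs over an unbounded space, so the weight has to pay for infinitely many
  lattice points. For large q the power rho^q lies below a multiple of the product of (1+|z_b|)^(-2)
  over the N = 2d coordinates, whose lattice sum factors into one-dimensional sums and is O(h^(-N))
  for mesh h. The chaining has a pathwise half and an averaged half. Increments at level n have q-th
  moments of order 2^(-nq) against 2^(nN) lattice points; asking pathwise only for the decay (3/4)^n
  leaves the ratio 2^N (2/3)^q, below 1 for large q. The separation also deals with null sets: U is
  linear only almost surely, with an exceptional set depending on the test functions, so linearity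
  is used under the expectation at two fixed points, while the pathwise half uses continuity alone.
  The mesh 8^(-j) reflects the anisotropy: |zeta|_a of order 2^j allows a Euclidean frequency of
  order 2^(3j). The spectral measure is signed, and the variance is bounded through its total
  variation. The return from q to p is t^p <= 1 + t^q on a probability space.\<close>

lemma nn_integral_std_normal_even_moment:
  "(\<integral>\<^sup>+x. ennreal ((s * x) ^ (2 * r)) \<partial>std_normal_distribution) =
     ennreal (fact (2 * r) / (2 ^ r * fact r) * (s\<^sup>2) ^ r)"
proof -
  have hb: "has_bochner_integral lborel (\<lambda>x. s ^ (2 * r) * (std_normal_density x * x ^ (2 * r)))
      (s ^ (2 * r) * (fact (2 * r) / (2 ^ r * fact r)))"
    by (intro has_bochner_integral_mult_right std_normal_moment_even)
  have "(\<integral>\<^sup>+x. ennreal ((s * x) ^ (2 * r)) \<partial>std_normal_distribution) =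
      (\<integral>\<^sup>+x. ennreal (s ^ (2 * r) * (std_normal_density x * x ^ (2 * r))) \<partial>lborel)"
    by (subst nn_integral_density)
       (auto simp: ennreal_mult'[symmetric] power_mult_distrib mult_ac intro!: nn_integral_cong)
  also have "\<dots> = ennreal (s ^ (2 * r) * (fact (2 * r) / (2 ^ r * fact r)))"
    using hb by (subst nn_integral_eq_integral)
      (auto simp: has_bochner_integral_iff zero_le_even_power intro!: mult_nonneg_nonneg)
  finally show ?thesis unfolding power_mult[of s 2 r] by (simp only: mult.commute)
qed

text \<open>Levy uniqueness identifies the law from its characteristic function. Describing it as
  the image of the standard normal law under a scaling, not by a density, includes the degenerate
  case of variance 0.\<close>

lemma centered_gaussian_distr:
  assumes M: "prob_space M" and X: "centered_gaussian M X"
  obtains s where "distr M borel X = distr std_normal_distribution borel (\<lambda>x. s * x)"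
proof -
  from X obtain s2 where Xm[measurable]: "X \<in> borel_measurable M" and s2: "s2 \<ge> 0"
    and ch: "\<And>t. char (distr M borel X) t = complex_of_real (exp (- s2 * t^2 / 2))"
    unfolding centered_gaussian_def by blast
  interpret prob_space M by fact
  interpret std: real_distribution std_normal_distribution
    by (rule real_dist_normal_dist)
  have "char (distr std_normal_distribution borel (\<lambda>x. sqrt s2 * x)) t =
      complex_of_real (exp (- s2 * t^2 / 2))" for t
  proof -
    have "char (distr std_normal_distribution borel (\<lambda>x. sqrt s2 * x)) t =
        char std_normal_distribution (t * sqrt s2)"
      unfolding char_def by (subst integral_distr) (auto simp: mult_ac)
    then show ?thesis using s2
      by (simp add: char_std_normal_distribution power_mult_distrib mult_ac)
  qed
  then have "distr M borel X = distr std_normal_distribution borel (\<lambda>x. sqrt s2 * x)"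
    by (intro Levy_uniqueness) (auto simp: fun_eq_iff ch intro!: real_distribution_distr)
  then show ?thesis by (rule that)
qed

lemma centered_gaussian_even_moment:
  assumes M: "prob_space M" and X: "centered_gaussian M X"
  shows "(\<integral>\<^sup>+\<omega>. ennreal (X \<omega> ^ (2 * r)) \<partial>M) =
     ennreal (fact (2 * r) / (2 ^ r * fact r) * (\<integral>\<omega>. X \<omega> * X \<omega> \<partial>M) ^ r)"
proof -
  have Xm[measurable]: "X \<in> borel_measurable M" using X by (simp add: centered_gaussian_def)
  obtain s where d: "distr M borel X = distr std_normal_distribution borel (\<lambda>x. s * x)"
    using centered_gaussian_distr[OF M X] .
  have mom: "(\<integral>\<^sup>+\<omega>. ennreal (X \<omega> ^ (2 * r)) \<partial>M) =
      ennreal (fact (2 * r) / (2 ^ r * fact r) * (s\<^sup>2) ^ r)" for r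
  proof -
    have "(\<integral>\<^sup>+\<omega>. ennreal (X \<omega> ^ (2 * r)) \<partial>M) = (\<integral>\<^sup>+x. ennreal (x ^ (2 * r)) \<partial>distr M borel X)"
      by (subst nn_integral_distr) auto
    also have "\<dots> = (\<integral>\<^sup>+x. ennreal ((s * x) ^ (2 * r)) \<partial>std_normal_distribution)"
      unfolding d by (subst nn_integral_distr) auto
    finally show ?thesis by (simp only: nn_integral_std_normal_even_moment)
  qed
  \<comment> \<open>The moment formula with r = 1 identifies the squared scale with the
    variance.\<close>
  have "(\<integral>\<omega>. X \<omega> * X \<omega> \<partial>M) = s\<^sup>2"
    using mom[of 1] by (intro integral_eq_nn_integral[THEN trans])
      (auto simp: power2_eq_square fact_numeral)
  then show ?thesis using mom by simp
qed

section \<open>Chaining on a dyadic lattice\<close>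

definition grid_pt :: "real \<Rightarrow> ('a::euclidean_space \<Rightarrow> int) \<Rightarrow> 'a" where
  "grid_pt h k = (\<Sum>b\<in>Basis. (h * of_int (k b)) *\<^sub>R b)"

definition cell :: "real \<Rightarrow> 'a::euclidean_space \<Rightarrow> 'a \<Rightarrow> int" where
  "cell h z = (\<lambda>b\<in>Basis. \<lfloor>(z \<bullet> b) / h\<rfloor>)"

definition coarsen :: "('a::euclidean_space \<Rightarrow> int) \<Rightarrow> 'a \<Rightarrow> int" where
  "coarsen k = (\<lambda>b\<in>Basis. k b div 2)"

text \<open>Integer vectors as extensional functions on the basis: there are countably many, and
  counting measure on them is a finite product of counting measures.\<close>

definition lattice :: "('a::euclidean_space \<Rightarrow> int) set" where
  "lattice = PiE Basis (\<lambda>_. UNIV)"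

text \<open>A product over coordinates instead of a power of the norm, so that its integral and its
  lattice sums factor. The exponent 2 is the least integer for which the factors are
  summable.\<close>

definition poly_weight :: "'a::euclidean_space \<Rightarrow> real" where
  "poly_weight z = (\<Prod>b\<in>Basis. inverse ((1 + \<bar>z \<bullet> b\<bar>)\<^sup>2))"

lemma poly_weight_pos: "poly_weight z > 0"
  unfolding poly_weight_def by (intro prod_pos) (auto simp: add_pos_nonneg zero_less_power)

lemma grid_pt_inner: "b \<in> Basis \<Longrightarrow> grid_pt h k \<bullet> b = h * of_int (k b)"
  by (simp add: grid_pt_def inner_sum_left_Basis)

lemma cell_in_lattice: "cell h z \<in> lattice"
  by (simp add: cell_def lattice_def)

lemma countable_lattice: "countable (lattice :: ('a::euclidean_space \<Rightarrow> int) set)"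
  unfolding lattice_def by (rule countable_PiE) auto

text \<open>Nested floors: halving the floor of 2x with integer division gives the floor of
  x.\<close>

lemma coarsen_cell: "coarsen (cell (h / 2) z) = cell h z"
proof -
  have "\<lfloor>(z \<bullet> b) / (h / 2)\<rfloor> div 2 = \<lfloor>(z \<bullet> b) / h\<rfloor>" for b
    using floor_divide_real_eq_div[of 2 "(z \<bullet> b) / (h / 2)"] by simp
  then show ?thesis by (auto simp: coarsen_def cell_def)
qed

lemma norm_le_DIM_bound:
  fixes x :: "'a::euclidean_space"
  assumes "\<And>b. b \<in> Basis \<Longrightarrow> \<bar>x \<bullet> b\<bar> \<le> c"
  shows "norm x \<le> real DIM('a) * c"
proof -
  have "norm x \<le> (\<Sum>b\<in>Basis. \<bar>x \<bullet> b\<bar>)" by (rule norm_le_l1)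
  also have "\<dots> \<le> (\<Sum>b\<in>(Basis::'a set). c)" by (intro sum_mono assms)
  finally show ?thesis by simp
qed

lemma grid_cell_near:
  assumes "h > 0" "b \<in> Basis"
  shows "\<bar>(grid_pt h (cell h z) - z) \<bullet> b\<bar> \<le> h"
proof -
  let ?x = "(z \<bullet> b) / h"
  have "(grid_pt h (cell h z) - z) \<bullet> b = h * (of_int \<lfloor>?x\<rfloor> - ?x)"
    using assms by (simp add: inner_diff_left grid_pt_inner cell_def right_diff_distrib)
  then have "\<bar>(grid_pt h (cell h z) - z) \<bullet> b\<bar> = \<bar>h * (of_int \<lfloor>?x\<rfloor> - ?x)\<bar>" by simp
  also have "\<dots> = h * \<bar>of_int \<lfloor>?x\<rfloor> - ?x\<bar>" using assms by (simp add: abs_mult)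
  also have "\<dots> \<le> h * 1" using assms by (intro mult_left_mono) linarith+
  finally show ?thesis by simp
qed

text \<open>In each coordinate the two points differ by h/2 times the remainder of
  \<open>k b\<close> modulo 2.\<close>

lemma grid_coarsen_near:
  fixes k :: "'a::euclidean_space \<Rightarrow> int"
  assumes "h > 0"
  shows "norm (grid_pt (h / 2) k - grid_pt h (coarsen k)) \<le> real DIM('a) * h"
proof (rule norm_le_DIM_bound)
  fix b :: 'a assume b: "b \<in> Basis"
  have "k b = 2 * (k b div 2) + k b mod 2" by simp
  then have "real_of_int (k b) = 2 * of_int (k b div 2) + of_int (k b mod 2)"
    by linarith
  then have "(grid_pt (h / 2) k - grid_pt h (coarsen k)) \<bullet> b = h / 2 * of_int (k b mod 2)"
    using b by (simp add: inner_diff_left grid_pt_inner coarsen_def field_simps)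
  moreover have "0 \<le> k b mod 2" "k b mod 2 \<le> 1" by auto
  then have "0 \<le> real_of_int (k b mod 2)" "real_of_int (k b mod 2) \<le> 1" by linarith+
  then have "0 \<le> h / 2 * real_of_int (k b mod 2)" "h / 2 * real_of_int (k b mod 2) \<le> h / 2 * 1"
    using assms by (intro mult_nonneg_nonneg mult_left_mono; simp)+
  ultimately show "\<bar>(grid_pt (h / 2) k - grid_pt h (coarsen k)) \<bullet> b\<bar> \<le> h"
    using assms by linarith
qed

text \<open>Each coordinate costs a factor 4, since 1 + |u_b| <= 2 (1 + |z_b|). This moves the
  weight from a point to a nearby lattice point.\<close>

lemma poly_weight_near:
  fixes u z :: "'a::euclidean_space"
  assumes "\<And>b. b \<in> Basis \<Longrightarrow> \<bar>(u - z) \<bullet> b\<bar> \<le> 1"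
  shows "poly_weight z \<le> 4 ^ DIM('a) * poly_weight u"
proof -
  have "poly_weight z \<le> (\<Prod>b\<in>Basis. 4 * inverse ((1 + \<bar>u \<bullet> b\<bar>)\<^sup>2))"
    unfolding poly_weight_def
  proof (rule prod_mono, safe)
    fix b :: 'a assume b: "b \<in> Basis"
    have "\<bar>u \<bullet> b\<bar> \<le> \<bar>z \<bullet> b\<bar> + 1" using assms[OF b] by (simp add: inner_diff_left)
    then have "(1 + \<bar>u \<bullet> b\<bar>)\<^sup>2 \<le> (2 * (1 + \<bar>z \<bullet> b\<bar>))\<^sup>2" by (intro power_mono) auto
    then have "(1 + \<bar>u \<bullet> b\<bar>)\<^sup>2 \<le> 4 * (1 + \<bar>z \<bullet> b\<bar>)\<^sup>2"
      unfolding power_mult_distrib by simp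
    moreover have "0 < (1 + \<bar>u \<bullet> b\<bar>)\<^sup>2" "0 < (1 + \<bar>z \<bullet> b\<bar>)\<^sup>2" by (auto simp: add_pos_nonneg)
    ultimately show "inverse ((1 + \<bar>z \<bullet> b\<bar>)\<^sup>2) \<le> 4 * inverse ((1 + \<bar>u \<bullet> b\<bar>)\<^sup>2)"
      by (simp add: field_simps)
  qed (auto)
  then show ?thesis by (simp add: poly_weight_def prod.distrib)
qed

section \<open>Lattice sums of the polynomial weight\<close>

lemma suminf_inverse_square_le:
  assumes h: "0 < h" "h \<le> 1"
  shows "(\<Sum>n::nat. ennreal (inverse ((1 + h * real n)\<^sup>2))) \<le> ennreal (2 / h)"
proof (rule suminf_le_const)
  fix n :: nat
  have fin: "(\<Sum>k<n. inverse ((1 + h * real k)\<^sup>2)) \<le> 2 / h" for n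
  proof -
    \<comment> \<open>Telescoping: with x = 1 + h n, the next term 1/(x+h)^2 is at most 1/(x (x+h))
      = (1/x - 1/(x+h))/h. The first term, 1, stands apart, and 1 + 1/h <= 2/h because h <=
      1.\<close>
    have "(\<Sum>k<Suc n. inverse ((1 + h * real k)\<^sup>2)) \<le> 1 + 1 / h * (1 - inverse (1 + h * real n))" for n
    proof (induction n)
      case (Suc n)
      define x where "x = 1 + h * real n"
      have x: "x \<ge> 1" using h by (simp add: x_def)
      have "inverse ((x + h)\<^sup>2) \<le> inverse (x * (x + h))"
        using x h by (intro le_imp_inverse_le) (auto simp: power2_eq_square intro!: mult_mono)
      also have "\<dots> = 1 / h * (inverse x - inverse (x + h))"
        using x h by (simp add: field_simps)
      finally show ?case using Suc.IH by (simp add: x_def algebra_simps)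
    qed simp
    from this[of n] have "(\<Sum>k<Suc n. inverse ((1 + h * real k)\<^sup>2)) \<le> 1 + 1 / h * 1"
      using h by (elim order_trans) (intro add_left_mono mult_left_mono, auto)
    also have "\<dots> \<le> 2 / h" using h by (simp add: field_simps)
    finally have "(\<Sum>k<Suc n. inverse ((1 + h * real k)\<^sup>2)) \<le> 2 / h" .
    moreover have "0 \<le> inverse ((1 + h * real n)\<^sup>2)" by simp
    ultimately show ?thesis unfolding sum.lessThan_Suc by linarith
  qed
  show "(\<Sum>k<n. ennreal (inverse ((1 + h * real k)\<^sup>2))) \<le> ennreal (2 / h)"
    using fin[of n] by (subst sum_ennreal) (auto intro: ennreal_leI)
qed simp

text \<open>The integers are covered by the nonnegative and the nonpositive ones, with 0 counted
  twice; each half contributes 2/h.\<close>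

lemma nn_integral_int_inverse_square_le:
  assumes h: "0 < h" "h \<le> 1"
  shows "(\<integral>\<^sup>+k. ennreal (inverse ((1 + \<bar>h * real_of_int k\<bar>)\<^sup>2)) \<partial>count_space UNIV) \<le> ennreal (4 / h)"
proof -
  define f where "f k = ennreal (inverse ((1 + \<bar>h * real_of_int k\<bar>)\<^sup>2))" for k :: int
  define g where "g n = - int n" for n
  have half: "(\<integral>\<^sup>+k. f k \<partial>count_space (range i)) \<le> ennreal (2 / h)"
    if i: "inj i" "\<And>n. \<bar>i n\<bar> = int n" for i :: "nat \<Rightarrow> int"
  proof -
    have "(\<integral>\<^sup>+k. f k \<partial>count_space (range i)) = (\<integral>\<^sup>+n. f (i n) \<partial>count_space UNIV)"
      using i(1) by (intro nn_integral_bij_count_space[symmetric]) (simp add: bij_betw_def)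
    also have "\<dots> = (\<Sum>n. ennreal (inverse ((1 + h * real n)\<^sup>2)))"
    proof -
      have "\<bar>h * real_of_int (i n)\<bar> = h * real n" for n
        using h i(2)[of n] by (simp add: abs_mult flip: of_int_abs)
      then show ?thesis by (simp add: nn_integral_count_space_nat f_def)
    qed
    finally show ?thesis using suminf_inverse_square_le[OF h] by simp
  qed
  have cover: "k \<in> range int \<or> k \<in> range g" for k
    by (cases k) (auto simp: g_def image_iff simp del: of_nat_Suc)
  have "(\<integral>\<^sup>+k. f k \<partial>count_space UNIV) \<le>
      (\<integral>\<^sup>+k. f k * indicator (range int) k + f k * indicator (range g) k \<partial>count_space UNIV)"
    using cover by (intro nn_integral_mono) (auto simp: indicator_def)
  also have "\<dots> = (\<integral>\<^sup>+k. f k \<partial>count_space (range int)) + (\<integral>\<^sup>+k. f k \<partial>count_space (range g))"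
    by (subst nn_integral_add) (auto simp: nn_integral_count_space_indicator)
  also have "\<dots> \<le> ennreal (2 / h) + ennreal (2 / h)"
    by (intro add_mono half) (auto simp: g_def inj_on_def)
  also have "\<dots> = ennreal (4 / h)" using h by (simp flip: ennreal_plus)
  finally show ?thesis by (simp add: f_def)
qed

text \<open>Tonelli for the product of counting measures reduces this to one coordinate. The power
  of 1/h is the density of lattice points.\<close>

lemma grid_weight_sum_le:
  assumes h: "0 < h" "h \<le> 1"
  shows "(\<integral>\<^sup>+k. ennreal (poly_weight (grid_pt h k :: 'a::euclidean_space)) \<partial>count_space lattice)
      \<le> ennreal ((4 / h) ^ DIM('a))"
proof -
  let ?f = "\<lambda>k. ennreal (inverse ((1 + \<bar>h * real_of_int k\<bar>)\<^sup>2))"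
  interpret product_sigma_finite "\<lambda>_::'a. count_space (UNIV::int set)"
    by (rule product_sigma_finite.intro) (rule sigma_finite_measure_count_space)
  have "count_space (lattice :: ('a \<Rightarrow> int) set) = PiM Basis (\<lambda>_::'a. count_space UNIV)"
    unfolding lattice_def by (rule count_space_PiM_finite[symmetric]) auto
  then have "(\<integral>\<^sup>+k. ennreal (poly_weight (grid_pt h k :: 'a)) \<partial>count_space lattice) =
      (\<integral>\<^sup>+k. (\<Prod>b\<in>(Basis::'a set). ?f (k b)) \<partial>PiM Basis (\<lambda>_. count_space UNIV))"
    by (auto simp: poly_weight_def grid_pt_inner prod_ennreal intro!: nn_integral_cong prod.cong)
  also have "\<dots> = (\<Prod>b\<in>(Basis::'a set). integral\<^sup>N (count_space UNIV) ?f)"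
    by (rule product_nn_integral_prod) auto
  also have "\<dots> \<le> (\<Prod>b\<in>(Basis::'a set). ennreal (4 / h))"
    by (intro prod_mono_ennreal nn_integral_int_inverse_square_le h)
  also have "\<dots> = ennreal ((4 / h) ^ DIM('a))" using h by (simp add: ennreal_power)
  finally show ?thesis .
qed

section \<open>Multiscale increments and the chaining bound\<close>

text \<open>Level 0 carries the value itself, so the increments along the cells of a point add up to
  a value and not merely to a difference.\<close>

definition chain_increment :: "real \<Rightarrow> ('a::euclidean_space \<Rightarrow> real) \<Rightarrow> nat \<Rightarrow> ('a \<Rightarrow> int) \<Rightarrow> real" where
  "chain_increment h X n k = (case n of 0 \<Rightarrow> X (grid_pt h k)
     | Suc m \<Rightarrow> X (grid_pt (h / 2 ^ n) k) - X (grid_pt (h / 2 ^ m) (coarsen k)))"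

text \<open>A weighted sum of q-th powers over all lattice points stands in for the maximum, so that
  its expectation can be taken term by term.\<close>

definition chain_level :: "real \<Rightarrow> nat \<Rightarrow> ('a::euclidean_space \<Rightarrow> real) \<Rightarrow> nat \<Rightarrow> ennreal" where
  "chain_level h q X n = (\<integral>\<^sup>+k. ennreal (poly_weight (grid_pt (h / 2 ^ n) k)) *
     ennreal (\<bar>chain_increment h X n k\<bar> ^ q) \<partial>count_space lattice)"

text \<open>The factor \<open>4 ^ q\<close> is the q-th power of the sum of all (3/4)^n, and
  \<open>4 ^ DIM('a)\<close> is the loss in \<open>poly_weight_near\<close>. The decay 3/4 could be
  any ratio strictly between 1/2 and 1: summable along the chain, yet slower than the decay of the
  moments.\<close>

definition chain_bound :: "real \<Rightarrow> nat \<Rightarrow> ('a::euclidean_space \<Rightarrow> real) \<Rightarrow> ennreal" where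
  "chain_bound h q X = ennreal (4 ^ q * 4 ^ DIM('a)) * (\<Sum>n. ennreal ((4 / 3) ^ (n * q)) * chain_level h q X n)"

(* Coarsening maps the cell of z at one level to its cell at the previous level, so the increments telescope. *)
lemma sum_chain_increment:
  "(\<Sum>m\<le>n. chain_increment h X m (cell (h / 2 ^ m) z)) = X (grid_pt (h / 2 ^ n) (cell (h / 2 ^ n) z))"
proof (induction n)
  case (Suc n)
  have "coarsen (cell (h / 2 ^ Suc n) z) = cell (h / 2 ^ n) z"
    using coarsen_cell[of "h / 2 ^ n" z] by (simp add: field_simps)
  then have "chain_increment h X (Suc n) (cell (h / 2 ^ Suc n) z) =
      X (grid_pt (h / 2 ^ Suc n) (cell (h / 2 ^ Suc n) z)) - X (grid_pt (h / 2 ^ n) (cell (h / 2 ^ n) z))"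
    by (simp only: chain_increment_def nat.case)
  then show ?case unfolding sum.atMost_Suc Suc.IH by linarith
qed (simp add: chain_increment_def)

lemma grid_cell_tendsto:
  fixes z :: "'a::euclidean_space"
  assumes h: "0 < h"
  shows "(\<lambda>n. grid_pt (h / 2 ^ n) (cell (h / 2 ^ n) z)) \<longlonglongrightarrow> z"
proof (rule Lim_transform2[OF tendsto_const])
  show "(\<lambda>n. z - grid_pt (h / 2 ^ n) (cell (h / 2 ^ n) z)) \<longlonglongrightarrow> 0"
  proof (rule Lim_null_comparison)
    show "\<forall>\<^sub>F n in sequentially. norm (z - grid_pt (h / 2 ^ n) (cell (h / 2 ^ n) z))
        \<le> real DIM('a) * h * (1/2) ^ n"
    proof (intro always_eventually allI)
      fix n
      have "norm (grid_pt (h / 2 ^ n) (cell (h / 2 ^ n) z) - z) \<le> real DIM('a) * (h / 2 ^ n)"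
        by (intro norm_le_DIM_bound grid_cell_near) (use h in auto)
      then show "norm (z - grid_pt (h / 2 ^ n) (cell (h / 2 ^ n) z)) \<le> real DIM('a) * h * (1/2) ^ n"
        by (simp add: norm_minus_commute power_one_over field_simps)
    qed
    show "(\<lambda>n. real DIM('a) * h * (1/2) ^ n) \<longlonglongrightarrow> 0"
      by (intro tendsto_mult_right_zero LIMSEQ_realpow_zero) auto
  qed
qed

lemma dyadic_mesh:
  fixes h :: real
  assumes "0 < h" "h \<le> 1"
  shows "0 < h / 2 ^ n" "h / 2 ^ n \<le> 1"
proof -
  have "h / 2 ^ n \<le> h / 1" using assms by (intro divide_left_mono) auto
  then show "h / 2 ^ n \<le> 1" using assms by linarith
  show "0 < h / 2 ^ n" using assms by simp
qed

(* A finite chain bound forces the n-th increment at z to be at most c (3/4)^n, whence |X z| is at most 4 c. *)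
lemma weighted_power_le_chain_bound:
  fixes X :: "'a::euclidean_space \<Rightarrow> real"
  assumes h: "0 < h" "h \<le> 1" and cont: "continuous_on UNIV X" and q: "q > 0"
  shows "ennreal (poly_weight z * \<bar>X z\<bar> ^ q) \<le> chain_bound h q X"
proof (cases "(\<Sum>n. ennreal ((4 / 3) ^ (n * q)) * chain_level h q X n) = \<infinity>")
  case True
  then show ?thesis by (simp add: chain_bound_def ennreal_mult_eq_top_iff ennreal_top_mult ennreal_mult_top)
next
  case False
  let ?S = "\<Sum>n. ennreal ((4 / 3) ^ (n * q)) * chain_level h q X n"
  obtain s where s: "s \<ge> 0" "?S = ennreal s" using False by (cases ?S) auto
  define w where "w = poly_weight z"
  have w: "w > 0" by (simp add: w_def poly_weight_pos)
  define u where "u n = grid_pt (h / 2 ^ n) (cell (h / 2 ^ n) z)" for n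
  define a where "a n = \<bar>chain_increment h X n (cell (h / 2 ^ n) z)\<bar>" for n
  \<comment> \<open>Solves w c^q = 4^N s, which is the bound that one retained term of the sum
    yields at every level.\<close>
  define c where "c = root q (4 ^ DIM('a) * s / w)"
  have c: "c \<ge> 0" "c ^ q = 4 ^ DIM('a) * s / w" using q s w by (auto simp: c_def)
  have a_le: "a n \<le> c * (3/4) ^ n" for n
  proof -
    let ?k = "cell (h / 2 ^ n) z"
    note hn = dyadic_mesh[OF h, of n]
    have w_le: "w \<le> 4 ^ DIM('a) * poly_weight (u n)"
      unfolding w_def u_def
    proof (rule poly_weight_near)
      fix b :: 'a assume "b \<in> Basis"
      from grid_cell_near[OF hn(1) this, of z] hn(2)
      show "\<bar>(grid_pt (h / 2 ^ n) (cell (h / 2 ^ n) z) - z) \<bullet> b\<bar> \<le> 1" by linarith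
    qed
    \<comment> \<open>Of the whole lattice sum only the term of the cell containing z is
      kept.\<close>
    have "ennreal (poly_weight (u n)) * ennreal (a n ^ q) \<le> chain_level h q X n"
      unfolding chain_level_def u_def a_def
      using nn_integral_ge_point[OF cell_in_lattice, of "\<lambda>k. ennreal (poly_weight (grid_pt (h / 2 ^ n) k)) *
         ennreal (\<bar>chain_increment h X n k\<bar> ^ q)" "h / 2 ^ n" z] by simp
    then have "ennreal ((4 / 3) ^ (n * q)) * (ennreal (poly_weight (u n)) * ennreal (a n ^ q)) \<le>
        ennreal ((4 / 3) ^ (n * q)) * chain_level h q X n"
      by (intro mult_left_mono) auto
    also have "\<dots> \<le> ?S"
      using sum_le_suminf[of "\<lambda>n. ennreal ((4 / 3) ^ (n * q)) * chain_level h q X n" "{n}"] by simp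
    finally have "ennreal ((4 / 3) ^ (n * q) * (poly_weight (u n) * a n ^ q)) \<le> ennreal s"
      using poly_weight_pos[of "u n"] by (simp add: s a_def ennreal_mult less_imp_le)
    then have le: "(4 / 3) ^ (n * q) * (poly_weight (u n) * a n ^ q) \<le> s"
      using s by (simp add: ennreal_le_iff)
    have "w * ((4/3) ^ n * a n) ^ q \<le> (4 ^ DIM('a) * poly_weight (u n)) * ((4/3) ^ n * a n) ^ q"
      by (intro mult_right_mono w_le) (auto simp: a_def)
    also have "\<dots> = 4 ^ DIM('a) * ((4 / 3) ^ (n * q) * (poly_weight (u n) * a n ^ q))"
      by (simp add: power_mult_distrib power_mult mult_ac)
    also have "\<dots> \<le> 4 ^ DIM('a) * s" by (intro mult_left_mono le) auto
    finally have "((4/3) ^ n * a n) ^ q \<le> c ^ q" using w by (simp add: c field_simps)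
    then have "(4/3) ^ n * a n \<le> c" using power_mono_iff[of "(4/3) ^ n * a n" c q] c q by (simp add: a_def)
    then show ?thesis by (simp add: power_divide field_simps)
  qed
  have Xu: "\<bar>X (u n)\<bar> \<le> 4 * c" for n
  proof -
    have "\<bar>X (u n)\<bar> \<le> (\<Sum>m\<le>n. a m)"
      unfolding u_def a_def sum_chain_increment[symmetric] by (rule sum_abs)
    also have "\<dots> \<le> (\<Sum>m\<le>n. c * (3/4) ^ m)" by (intro sum_mono a_le)
    also have "\<dots> = c * (\<Sum>m<Suc n. (3/4) ^ m)" by (simp add: sum_distrib_left lessThan_Suc_atMost)
    also have "\<dots> \<le> c * 4"
      by (intro mult_left_mono c, subst geometric_sum) auto
    finally show ?thesis by simp
  qed
  \<comment> \<open>Continuity carries the bound from the lattice points approaching z to z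
    itself.\<close>
  have "(\<lambda>n. X (u n)) \<longlonglongrightarrow> X z"
    unfolding u_def using cont
    by (intro isCont_tendsto_compose[OF _ grid_cell_tendsto[OF h(1)]])
       (auto simp: continuous_on_eq_continuous_at)
  then have "\<bar>X z\<bar> \<le> 4 * c" by (intro LIMSEQ_le_const2[OF tendsto_rabs]) (auto intro: Xu)
  then have "\<bar>X z\<bar> ^ q \<le> (4 * c) ^ q" by (intro power_mono) auto
  then have "w * \<bar>X z\<bar> ^ q \<le> 4 ^ q * 4 ^ DIM('a) * s" using w by (simp add: power_mult_distrib c field_simps)
  then show ?thesis using s w
    by (simp add: chain_bound_def w_def ennreal_mult'[symmetric] ennreal_leI)
qed

text \<open>By Tonelli the expectation is taken at each lattice point. Level n has q-th moments at
  most A (2N)^q 2^(-nq) and total weight at most (4/h)^N 2^(nN), with N = \<open>DIM('a)\<close>.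
  Multiplied by (4/3)^(nq) this leaves (2^N (2/3)^q)^n, which the last hypothesis bounds by
  2^(-n).\<close>

lemma nn_integral_chain_level_le:
  fixes X :: "'a::euclidean_space \<Rightarrow> 'w \<Rightarrow> real"
  assumes h: "0 < h" "h \<le> 1"
    and meas[measurable]: "\<And>z. X z \<in> borel_measurable M"
    and A: "0 \<le> A" "\<And>z. (\<integral>\<^sup>+\<omega>. ennreal (\<bar>X z \<omega>\<bar> ^ q) \<partial>M) \<le> ennreal A"
    and incr: "\<And>z w. (\<integral>\<^sup>+\<omega>. ennreal (\<bar>X z \<omega> - X w \<omega>\<bar> ^ q) \<partial>M) \<le> ennreal (A * (norm (z - w) / h) ^ q)"
    and q: "2 ^ DIM('a) * (2 / 3) ^ q \<le> (1 / 2 :: real)"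
  shows "ennreal ((4 / 3) ^ (n * q)) * (\<integral>\<^sup>+\<omega>. chain_level h q (\<lambda>z. X z \<omega>) n \<partial>M)
      \<le> ennreal (A * (2 * real DIM('a)) ^ q * (4 / h) ^ DIM('a) * (1 / 2) ^ n)"
proof -
  let ?N = "DIM('a)"
  note hn = dyadic_mesh[OF h]
  have N1: "real ?N \<ge> 1" using DIM_positive[where 'a='a] by linarith
  have ci[measurable]: "(\<lambda>\<omega>. chain_increment h (\<lambda>z. X z \<omega>) n k) \<in> borel_measurable M" for n k
    unfolding chain_increment_def by (cases n) auto
  \<comment> \<open>One formula for all levels: since 2N >= 1, it also dominates the bound
    \<open>A\<close> on the values at level 0.\<close>
  define B where "B = A * (2 * real ?N) ^ q * (1/2) ^ (n * q)"
  have B0: "B \<ge> 0" using A by (simp add: B_def)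
  have B: "(\<integral>\<^sup>+\<omega>. ennreal (\<bar>chain_increment h (\<lambda>z. X z \<omega>) n k\<bar> ^ q) \<partial>M) \<le> ennreal B" for k
  proof (cases n)
    case 0
    have "A * 1 \<le> A * (2 * real ?N) ^ q" using N1 A(1) by (intro mult_left_mono one_le_power) linarith+
    then show ?thesis
      using A(2)[of "grid_pt h k"] by (auto simp: chain_increment_def 0 B_def elim!: order_trans intro!: ennreal_leI)
  next
    case (Suc m)
    have "norm (grid_pt (h / 2 ^ n) k - grid_pt (h / 2 ^ m) (coarsen k)) \<le> real ?N * (h / 2 ^ m)"
      using grid_coarsen_near[of "h / 2 ^ m" k] h by (simp add: Suc field_simps)
    \<comment> \<open>The distance is measured in the coarser mesh h/2^m, which is twice h/2^n;
      hence 2N.\<close>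
    then have "norm (grid_pt (h / 2 ^ n) k - grid_pt (h / 2 ^ m) (coarsen k)) / h \<le> 2 * real ?N * (1/2) ^ n"
      using h by (simp add: Suc power_divide field_simps)
    then have "A * (norm (grid_pt (h / 2 ^ n) k - grid_pt (h / 2 ^ m) (coarsen k)) / h) ^ q \<le>
        A * (2 * real ?N * (1/2) ^ n) ^ q"
      using h A by (intro mult_left_mono power_mono) auto
    also have "\<dots> = B" by (simp only: B_def power_mult_distrib power_mult mult.assoc)
    finally show ?thesis
      using incr[of "grid_pt (h / 2 ^ n) k" "grid_pt (h / 2 ^ m) (coarsen k)"]
      by (auto simp: chain_increment_def Suc elim!: order_trans intro!: ennreal_leI)
  qed
  have "(\<integral>\<^sup>+\<omega>. chain_level h q (\<lambda>z. X z \<omega>) n \<partial>M) =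
      (\<integral>\<^sup>+k. (\<integral>\<^sup>+\<omega>. ennreal (poly_weight (grid_pt (h / 2 ^ n) k)) *
        ennreal (\<bar>chain_increment h (\<lambda>z. X z \<omega>) n k\<bar> ^ q) \<partial>M) \<partial>count_space lattice)"
    unfolding chain_level_def by (rule nn_integral_count_space_nn_integral[OF countable_lattice]) measurable
  also have "\<dots> = (\<integral>\<^sup>+k. ennreal (poly_weight (grid_pt (h / 2 ^ n) k)) *
        (\<integral>\<^sup>+\<omega>. ennreal (\<bar>chain_increment h (\<lambda>z. X z \<omega>) n k\<bar> ^ q) \<partial>M) \<partial>count_space lattice)"
    by (subst nn_integral_cmult) auto
  also have "\<dots> \<le> (\<integral>\<^sup>+k. ennreal (poly_weight (grid_pt (h / 2 ^ n) k :: 'a)) * ennreal B \<partial>count_space lattice)"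
    by (intro nn_integral_mono mult_left_mono B) auto
  also have "\<dots> = (\<integral>\<^sup>+k. ennreal (poly_weight (grid_pt (h / 2 ^ n) k :: 'a)) \<partial>count_space lattice) * ennreal B"
    by (rule nn_integral_multc) auto
  also have "\<dots> \<le> ennreal ((4 / (h / 2 ^ n)) ^ ?N) * ennreal B"
    by (intro mult_right_mono grid_weight_sum_le hn) auto
  finally have "ennreal ((4 / 3) ^ (n * q)) * (\<integral>\<^sup>+\<omega>. chain_level h q (\<lambda>z. X z \<omega>) n \<partial>M)
      \<le> ennreal ((4 / 3) ^ (n * q)) * (ennreal ((4 / (h / 2 ^ n)) ^ ?N) * ennreal B)"
    by (intro mult_left_mono) auto
  also have "\<dots> = ennreal ((4 / 3) ^ (n * q) * ((4 / (h / 2 ^ n)) ^ ?N * B))"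
    using h B0 by (simp add: ennreal_mult)
  also have "(4 / 3) ^ (n * q) * ((4 / (h / 2 ^ n)) ^ ?N * B) =
      A * (2 * real ?N) ^ q * (4 / h) ^ ?N * ((2 ^ ?N) ^ n * (((4 / 3) ^ (n * q) * (1/2) ^ (n * q))))"
  proof -
    have "(4 / (h / 2 ^ n)) ^ ?N = (4 / h) ^ ?N * (2 ^ ?N) ^ n"
      by (simp add: power_mult_distrib power_divide mult_ac flip: power_mult)
    then show ?thesis by (simp add: B_def mult_ac)
  qed
  also have "(4 / 3) ^ (n * q) * (1/2) ^ (n * q) = ((2 / 3 :: real) ^ q) ^ n"
    unfolding power_mult_distrib[symmetric] power_mult[symmetric] by (simp add: mult.commute)
  also have "(2 ^ ?N) ^ n * ((2 / 3) ^ q) ^ n = (2 ^ ?N * (2 / 3 :: real) ^ q) ^ n"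
    by (simp only: power_mult_distrib)
  also have "ennreal (A * (2 * real ?N) ^ q * (4 / h) ^ ?N * (2 ^ ?N * (2 / 3) ^ q) ^ n) \<le>
      ennreal (A * (2 * real ?N) ^ q * (4 / h) ^ ?N * (1 / 2) ^ n)"
    using A h by (intro ennreal_leI mult_left_mono power_mono q) auto
  finally show ?thesis .
qed

text \<open>As the lattice is countable, measurability at each fixed point gives joint measurability
  with respect to counting measure, hence measurability of the sum as a function of
  \<open>\<omega>\<close>.\<close>

lemma borel_measurable_chain_bound:
  fixes X :: "'a::euclidean_space \<Rightarrow> 'w \<Rightarrow> real"
  assumes [measurable]: "\<And>z. X z \<in> borel_measurable M"
  shows "(\<lambda>\<omega>. chain_level h q (\<lambda>z. X z \<omega>) n) \<in> borel_measurable M"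
    and "(\<lambda>\<omega>. chain_bound h q (\<lambda>z. X z \<omega>)) \<in> borel_measurable M"
proof -
  have ci[measurable]: "(\<lambda>\<omega>. chain_increment h (\<lambda>z. X z \<omega>) n k) \<in> borel_measurable M" for n k
    unfolding chain_increment_def by (cases n) auto
  interpret sigma_finite_measure "count_space (lattice :: ('a \<Rightarrow> int) set)"
    by (rule sigma_finite_measure_count_space_countable[OF countable_lattice])
  show [measurable]: "(\<lambda>\<omega>. chain_level h q (\<lambda>z. X z \<omega>) n) \<in> borel_measurable M" for n
    unfolding chain_level_def
    by (rule borel_measurable_nn_integral, subst measurable_pair_swap_iff,
        rule measurable_pair_measure_countable1[OF countable_lattice]) auto
  show "(\<lambda>\<omega>. chain_bound h q (\<lambda>z. X z \<omega>)) \<in> borel_measurable M"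
    unfolding chain_bound_def by measurable
qed

lemma nn_integral_chain_bound_le:
  fixes X :: "'a::euclidean_space \<Rightarrow> 'w \<Rightarrow> real"
  assumes h: "0 < h" "h \<le> 1"
    and meas[measurable]: "\<And>z. X z \<in> borel_measurable M"
    and A: "0 \<le> A" "\<And>z. (\<integral>\<^sup>+\<omega>. ennreal (\<bar>X z \<omega>\<bar> ^ q) \<partial>M) \<le> ennreal A"
    and incr: "\<And>z w. (\<integral>\<^sup>+\<omega>. ennreal (\<bar>X z \<omega> - X w \<omega>\<bar> ^ q) \<partial>M) \<le> ennreal (A * (norm (z - w) / h) ^ q)"
    and q: "2 ^ DIM('a) * (2 / 3) ^ q \<le> (1 / 2 :: real)"
  shows "(\<integral>\<^sup>+\<omega>. chain_bound h q (\<lambda>z. X z \<omega>) \<partial>M)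
      \<le> ennreal (A * (2 * (8 * real DIM('a)) ^ q * (16 / h) ^ DIM('a)))"
proof -
  note [measurable] = borel_measurable_chain_bound[of X M, OF meas]
  let ?K = "A * (2 * real DIM('a)) ^ q * (4 / h) ^ DIM('a)"
  have "(\<integral>\<^sup>+\<omega>. chain_bound h q (\<lambda>z. X z \<omega>) \<partial>M) = ennreal (4 ^ q * 4 ^ DIM('a)) *
      (\<Sum>n. ennreal ((4 / 3) ^ (n * q)) * (\<integral>\<^sup>+\<omega>. chain_level h q (\<lambda>z. X z \<omega>) n \<partial>M))"
    unfolding chain_bound_def by (simp add: nn_integral_cmult nn_integral_suminf)
  also have "\<dots> \<le> ennreal (4 ^ q * 4 ^ DIM('a)) * (\<Sum>n. ennreal (?K * (1 / 2) ^ n))"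
    by (intro mult_left_mono suminf_le nn_integral_chain_level_le[OF h meas A incr q]) auto
  also have "(\<Sum>n. ennreal (?K * (1 / 2) ^ n)) = ennreal (?K * 2)"
    using A(1) h sums_mult[OF geometric_sums[of "1/2::real"], of ?K]
    by (intro suminf_ennreal_eq) auto
  also have "ennreal (4 ^ q * 4 ^ DIM('a)) * ennreal (?K * 2) =
      ennreal (A * (2 * (4 ^ q * (2 * real DIM('a)) ^ q) * (4 ^ DIM('a) * (4 / h) ^ DIM('a))))"
    using A(1) h by (simp add: ennreal_mult'[symmetric] mult_ac)
  also have "4 ^ q * (2 * real DIM('a)) ^ q = (8 * real DIM('a)) ^ q"
    unfolding power_mult_distrib[symmetric] by simp
  also have "4 ^ DIM('a) * (4 / h) ^ DIM('a) = (16 / h) ^ DIM('a)"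
    unfolding power_mult_distrib[symmetric] by simp
  finally show ?thesis .
qed

section \<open>Smooth and Schwartz functions on phase space\<close>

(* Points of phase space are pairs; without this, auto replaces quantified points by their components. *)
declare split_paired_All [simp del] split_paired_Ex [simp del]

lemma iter_dderiv_append: "iter_dderiv (us @ vs) f = iter_dderiv us (iter_dderiv vs f)"
  by (induction us) auto

lemma smooth_fun_differentiable: "smooth_fun f \<Longrightarrow> f differentiable (at z)"
  unfolding smooth_fun_def by (metis iter_dderiv.simps(1))

lemma smooth_fun_iter_dderiv: "smooth_fun f \<Longrightarrow> smooth_fun (iter_dderiv vs f)"
  unfolding smooth_fun_def by (metis iter_dderiv_append)

lemma smooth_fun_dderiv: "smooth_fun f \<Longrightarrow> smooth_fun (\<lambda>z. frechet_derivative f (at z) v)"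
  using smooth_fun_iter_dderiv[of f "[v]"] by simp

lemma smooth_fun_has_derivative:
  "smooth_fun f \<Longrightarrow> (f has_derivative frechet_derivative f (at z)) (at z)"
  using smooth_fun_differentiable frechet_derivative_works by blast

lemma smooth_fun_continuous_on: "smooth_fun f \<Longrightarrow> continuous_on A f"
  by (intro continuous_at_imp_continuous_on ballI differentiable_imp_continuous_within
      smooth_fun_differentiable)

lemma smooth_fun_measurable [measurable_dest]:
  "smooth_fun f \<Longrightarrow> f \<in> borel_measurable borel"
  by (intro borel_measurable_continuous_onI smooth_fun_continuous_on)

lemma closed_class_iter_dderiv:
  assumes "\<And>f v. f \<in> S \<Longrightarrow> (\<lambda>z. frechet_derivative f (at z) v) \<in> S" "f \<in> S"
  shows "iter_dderiv vs f \<in> S"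
  using assms by (induction vs) auto

text \<open>Smoothness without formulas for iterated derivatives: it is enough to find a family of
  differentiable functions that is stable under directional derivatives.\<close>

lemma closed_class_smooth_fun:
  assumes "\<And>f z. f \<in> S \<Longrightarrow> f differentiable (at z)"
    and "\<And>f v. f \<in> S \<Longrightarrow> (\<lambda>z. frechet_derivative f (at z) v) \<in> S" "f \<in> S"
  shows "smooth_fun f"
  unfolding smooth_fun_def using closed_class_iter_dderiv[of S f] assms by blast

lemma iter_dderiv_lincomb:
  assumes "smooth_fun f" "smooth_fun g"
  shows "iter_dderiv vs (\<lambda>z. a * f z + b * g z) = (\<lambda>z. a * iter_dderiv vs f z + b * iter_dderiv vs g z)"
proof (induction vs)
  case (Cons v vs)
  have "((\<lambda>z. a * iter_dderiv vs f z + b * iter_dderiv vs g z) has_derivative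
      (\<lambda>h. a * frechet_derivative (iter_dderiv vs f) (at z) h + b * frechet_derivative (iter_dderiv vs g) (at z) h)) (at z)" for z
    by (intro derivative_intros smooth_fun_has_derivative smooth_fun_iter_dderiv assms)
  from frechet_derivative_at[OF this] show ?case
    by (auto simp: Cons.IH fun_eq_iff dest: fun_cong[where x=v])
qed simp

lemma smooth_fun_lincomb:
  assumes "smooth_fun f" "smooth_fun g"
  shows "smooth_fun (\<lambda>z. a * f z + b * g z)"
  unfolding smooth_fun_def iter_dderiv_lincomb[OF assms]
  using assms by (auto intro!: derivative_intros simp: smooth_fun_def)

text \<open>Chain rule: the linear part acts on the directions of differentiation. This serves for
  translations as well as for the anisotropic dilations.\<close>

lemma iter_dderiv_affine:
  assumes f: "smooth_fun f" and L: "bounded_linear L"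
  shows "iter_dderiv vs (\<lambda>z. f (L z + c)) = (\<lambda>z. iter_dderiv (map L vs) f (L z + c))"
proof (induction vs)
  case (Cons v vs)
  have "((\<lambda>z. iter_dderiv (map L vs) f (L z + c)) has_derivative
      (\<lambda>h. frechet_derivative (iter_dderiv (map L vs) f) (at (L z + c)) (L h))) (at z)" for z
    by (rule has_derivative_compose[OF _ smooth_fun_has_derivative[OF smooth_fun_iter_dderiv[OF f]]])
       (auto intro!: derivative_eq_intros bounded_linear_imp_has_derivative L)
  from frechet_derivative_at[OF this] show ?case
    by (auto simp: Cons.IH fun_eq_iff dest: fun_cong[where x=v])
qed simp

lemma smooth_fun_affine:
  assumes f: "smooth_fun f" and L: "bounded_linear L"
  shows "smooth_fun (\<lambda>z. f (L z + c))"
  unfolding smooth_fun_def iter_dderiv_affine[OF assms]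
proof (intro allI)
  fix vs z
  have "(\<lambda>z. L z + c) differentiable (at z)"
    by (intro derivative_intros bounded_linear_imp_differentiable L)
  then show "(\<lambda>z. iter_dderiv (map L vs) f (L z + c)) differentiable (at z)"
    using differentiable_chain_at[of "\<lambda>z. L z + c" z "iter_dderiv (map L vs) f"] f
    unfolding smooth_fun_def o_def by blast
qed

(* Products (z . w) f alone are not stable under differentiation, but the sums (z . w) f + g are. *)
lemma smooth_fun_inner_mult:
  assumes f: "smooth_fun f"
  shows "smooth_fun (\<lambda>z. (z \<bullet> w) * f z)"
proof (rule closed_class_smooth_fun)
  let ?S = "{\<lambda>z. (z \<bullet> w) * f z + g z | f g. smooth_fun f \<and> smooth_fun g}"
  have d: "((\<lambda>z. (z \<bullet> w) * f z + g z) has_derivative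
      (\<lambda>h. (z \<bullet> w) * frechet_derivative f (at z) h + (h \<bullet> w) * f z + frechet_derivative g (at z) h)) (at z)"
    if "smooth_fun f" "smooth_fun g" for f g z
    by (intro derivative_intros smooth_fun_has_derivative that)
  show "F differentiable (at z)" if "F \<in> ?S" for F z
    using that d unfolding differentiable_def by blast
  show "(\<lambda>z. frechet_derivative F (at z) v) \<in> ?S" if FS: "F \<in> ?S" for F v
  proof -
    from FS obtain f g where F: "F = (\<lambda>z. (z \<bullet> w) * f z + g z)" and s: "smooth_fun f" "smooth_fun g"
      by blast
    define g' where "g' z = (v \<bullet> w) * f z + 1 * frechet_derivative g (at z) v" for z
    have "smooth_fun g'" unfolding g'_def by (intro smooth_fun_lincomb smooth_fun_dderiv s)
    moreover have "(\<lambda>z. frechet_derivative F (at z) v) =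
        (\<lambda>z. (z \<bullet> w) * frechet_derivative f (at z) v + g' z)"
      using frechet_derivative_at[OF d[OF s], symmetric]
      by (auto simp: F g'_def fun_eq_iff)
    ultimately show ?thesis using smooth_fun_dderiv[OF s(1), of v]
      by (intro CollectI exI[of _ "\<lambda>z. frechet_derivative f (at z) v"] exI[of _ g']) simp
  qed
  \<comment> \<open>The zero function serves as the summand g, so the product itself belongs to the
    family.\<close>
  have "smooth_fun (\<lambda>z. 0 * f z + 0 * f z)" by (intro smooth_fun_lincomb f)
  then show "(\<lambda>z. (z \<bullet> w) * f z) \<in> ?S" using f by force
qed

section \<open>Compactly supported smooth functions\<close>

text \<open>With the radius explicit, the class for fixed R is stable under directional derivatives
  and under multiplication by linear forms.\<close>

definition bump :: "real \<Rightarrow> ('n::finite ph \<Rightarrow> real) \<Rightarrow> bool" where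
  "bump R f \<longleftrightarrow> smooth_fun f \<and> (\<forall>z. norm z > R \<longrightarrow> f z = 0)"

lemma bump_smooth: "bump R f \<Longrightarrow> smooth_fun f"
  by (simp add: bump_def)

text \<open>The exterior of the closed ball is open, so the function vanishes in a neighbourhood of
  each exterior point.\<close>

lemma bump_dderiv:
  fixes f :: "'n::finite ph \<Rightarrow> real"
  assumes f: "bump R f"
  shows "bump R (\<lambda>z. frechet_derivative f (at z) v)"
  unfolding bump_def
proof (intro conjI allI impI)
  show "smooth_fun (\<lambda>z. frechet_derivative f (at z) v)"
    using f by (simp add: bump_def smooth_fun_dderiv)
  fix z :: "'n ph" assume z: "norm z > R"
  have "open {z::'n ph. norm z > R}" by (intro open_Collect_less continuous_intros)
  then have "(f has_derivative (\<lambda>_. 0)) (at z)"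
    by (rule has_derivative_transform_within_open[OF has_derivative_const])
       (use z f in \<open>auto simp: bump_def\<close>)
  from frechet_derivative_at[OF this] show "frechet_derivative f (at z) v = 0"
    by (metis)
qed

lemma bump_inner_mult: "bump R f \<Longrightarrow> bump R (\<lambda>z. (z \<bullet> w) * f z)"
  by (simp add: bump_def smooth_fun_inner_mult)

lemma bump_bounded:
  assumes f: "bump R f"
  obtains B where "B \<ge> 0" "\<And>z. \<bar>f z\<bar> \<le> B"
proof -
  have "compact (f ` cball 0 R)"
    using f by (intro compact_continuous_image smooth_fun_continuous_on) (auto simp: bump_def)
  then obtain B where B: "\<And>y. y \<in> f ` cball 0 R \<Longrightarrow> norm y \<le> B"
    using compact_imp_bounded bounded_iff by metis
  have "\<bar>f z\<bar> \<le> max 0 B" for z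
    using B[of "f z"] f unfolding max_def by (cases "norm z \<le> R") (simp_all add: bump_def)
  then show ?thesis using that[of "max 0 B"] by simp
qed

lemma integrable_bounded_support:
  fixes f :: "'a::euclidean_space \<Rightarrow> real"
  assumes [measurable]: "f \<in> borel_measurable borel"
    and B: "\<And>z. \<bar>f z\<bar> \<le> B" and R: "\<And>z. norm z > R \<Longrightarrow> f z = 0"
  shows "integrable lborel f"
proof (rule Bochner_Integration.integrable_bound)
  show "integrable lborel (\<lambda>z::'a. B * indicator (cball 0 R) z)"
    by (intro integrable_mult_right integrable_real_indicator) (simp_all add: emeasure_bounded_finite[OF bounded_cball, simplified])
  show "AE z in lborel. norm (f z) \<le> norm (B * indicator (cball 0 R) z)"
    using B R by (intro AE_I2) (auto simp: indicator_def intro: order_trans[OF _ abs_ge_self])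
qed simp

lemma bump_mult_integrable:
  assumes f: "bump R f" and g: "continuous_on UNIV g"
  shows "integrable lborel (\<lambda>z. f z * g z)"
proof -
  note [measurable] = smooth_fun_measurable[OF bump_smooth[OF f]] borel_measurable_continuous_onI[OF g]
  obtain B where B: "B \<ge> 0" "\<And>z. \<bar>f z\<bar> \<le> B" using bump_bounded[OF f] by blast
  have "compact (g ` cball 0 R)"
    using g by (intro compact_continuous_image) (auto intro: continuous_on_subset)
  then obtain C where C: "\<And>y. y \<in> g ` cball 0 R \<Longrightarrow> norm y \<le> C"
    using compact_imp_bounded bounded_iff by metis
  have "\<bar>f z * g z\<bar> \<le> B * max 0 C" for z
  proof (cases "norm z \<le> R")
    case True
    then have "\<bar>g z\<bar> \<le> max 0 C" using C[of "g z"] by auto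
    then show ?thesis unfolding abs_mult using B(1) by (intro mult_mono B(2)) simp_all
  next
    case False
    then show ?thesis using f B(1) by (simp add: bump_def)
  qed
  then show ?thesis
    by (rule integrable_bounded_support[where R=R, rotated]) (use f in \<open>auto simp: bump_def\<close>)
qed

lemma bump_integrable: "bump R f \<Longrightarrow> integrable lborel f"
  using bump_mult_integrable[of R f "\<lambda>_. 1"] by simp

section \<open>Schwartz functions: linear combinations, translates, integrability\<close>

lemma schwartz_bounded:
  assumes "schwartz f"
  shows "\<exists>A. \<forall>z. \<bar>norm z ^ k * iter_dderiv vs f z\<bar> \<le> A"
proof -
  have "bounded (range (\<lambda>z. norm z ^ k * iter_dderiv vs f z))"
    using assms by (simp add: schwartz_def)
  then show ?thesis unfolding bounded_iff real_norm_def by blast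
qed

lemma schwartz_lincomb:
  assumes "schwartz f" "schwartz g"
  shows "schwartz (\<lambda>z. a * f z + b * g z)"
proof -
  have s: "smooth_fun f" "smooth_fun g" using assms by (auto simp: schwartz_def)
  have "bounded (range (\<lambda>z. norm z ^ k * (a * iter_dderiv vs f z + b * iter_dderiv vs g z)))" for vs k
  proof -
    from assms obtain A B where
      A: "\<And>z. \<bar>norm z ^ k * iter_dderiv vs f z\<bar> \<le> A" and B: "\<And>z. \<bar>norm z ^ k * iter_dderiv vs g z\<bar> \<le> B"
      using schwartz_bounded by metis
    have "\<bar>norm z ^ k * (a * iter_dderiv vs f z + b * iter_dderiv vs g z)\<bar> \<le> \<bar>a\<bar> * A + \<bar>b\<bar> * B" for z
    proof -
      have "norm z ^ k * (a * iter_dderiv vs f z + b * iter_dderiv vs g z) =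
          a * (norm z ^ k * iter_dderiv vs f z) + b * (norm z ^ k * iter_dderiv vs g z)"
        by (simp add: algebra_simps)
      also have "\<bar>\<dots>\<bar> \<le> \<bar>a\<bar> * \<bar>norm z ^ k * iter_dderiv vs f z\<bar> + \<bar>b\<bar> * \<bar>norm z ^ k * iter_dderiv vs g z\<bar>"
        unfolding abs_mult[of a, symmetric] abs_mult[of b, symmetric] by (rule abs_triangle_ineq)
      also have "\<dots> \<le> \<bar>a\<bar> * A + \<bar>b\<bar> * B" by (intro add_mono mult_left_mono A B) auto
      finally show ?thesis .
    qed
    then show ?thesis by (intro boundedI[where B="\<bar>a\<bar> * A + \<bar>b\<bar> * B"]) (elim imageE, simp only: real_norm_def)
  qed
  then show ?thesis using s by (simp add: schwartz_def smooth_fun_lincomb iter_dderiv_lincomb)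
qed

lemma power_add_le: "(a + b) ^ k \<le> 2 ^ k * (a ^ k + b ^ k)" if "0 \<le> a" "0 \<le> b" for a b :: real
proof -
  have "(a + b) ^ k \<le> (2 * max a b) ^ k" using that by (intro power_mono) auto
  also have "\<dots> = 2 ^ k * max a b ^ k" by (simp add: power_mult_distrib)
  also have "\<dots> \<le> 2 ^ k * (a ^ k + b ^ k)" using that by (intro mult_left_mono) (auto simp: max_def)
  finally show ?thesis .
qed

text \<open>The growth of |z|^k is split between |z - w|^k, absorbed by the decay of order k at z -
  w, and the constant |w|^k.\<close>

lemma schwartz_translate:
  assumes f: "schwartz f"
  shows "schwartz (translate w f)"
proof -
  have s: "smooth_fun f" using f by (auto simp: schwartz_def)
  have tr: "translate w f = (\<lambda>z. f (id z + - w))" by (simp add: translate_def)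
  have it: "iter_dderiv vs (translate w f) = (\<lambda>z. iter_dderiv vs f (z - w))" for vs
    unfolding tr by (subst iter_dderiv_affine[OF s bounded_linear_ident[folded id_def]]) simp
  have "bounded (range (\<lambda>z. norm z ^ k * iter_dderiv vs f (z - w)))" for vs k
  proof -
    from f obtain A B where
      A: "\<And>z. \<bar>norm z ^ k * iter_dderiv vs f z\<bar> \<le> A" and B: "\<And>z. \<bar>norm z ^ 0 * iter_dderiv vs f z\<bar> \<le> B"
      using schwartz_bounded by metis
    have "\<bar>norm z ^ k * iter_dderiv vs f (z - w)\<bar> \<le> 2 ^ k * (A + norm w ^ k * B)" for z
    proof -
      have "norm z ^ k \<le> (norm (z - w) + norm w) ^ k"
        using norm_triangle_ineq[of "z - w" w] by (intro power_mono) auto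
      also have "\<dots> \<le> 2 ^ k * (norm (z - w) ^ k + norm w ^ k)" by (rule power_add_le) auto
      finally have "\<bar>norm z ^ k * iter_dderiv vs f (z - w)\<bar> \<le>
          2 ^ k * (norm (z - w) ^ k + norm w ^ k) * \<bar>iter_dderiv vs f (z - w)\<bar>"
        by (auto simp: abs_mult intro!: mult_right_mono)
      also have "\<dots> = 2 ^ k * (\<bar>norm (z - w) ^ k * iter_dderiv vs f (z - w)\<bar> +
          norm w ^ k * \<bar>norm (z - w) ^ 0 * iter_dderiv vs f (z - w)\<bar>)"
        by (simp add: abs_mult algebra_simps)
      also have "\<dots> \<le> 2 ^ k * (A + norm w ^ k * B)"
        by (intro mult_left_mono add_mono A B) auto
      finally show ?thesis .
    qed
    then show ?thesis by (intro boundedI[where B="2 ^ k * (A + norm w ^ k * B)"]) (elim imageE, simp only: real_norm_def)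
  qed
  moreover have "smooth_fun (translate w f)"
    unfolding tr by (rule smooth_fun_affine[OF s bounded_linear_ident[folded id_def]])
  ultimately show ?thesis by (simp add: schwartz_def it)
qed

text \<open>Lebesgue measure and the weight both factor over the coordinates, and each factor is
  dominated by 1/(1 + x^2).\<close>

lemma integrable_poly_weight: "integrable lborel (poly_weight :: 'a::euclidean_space \<Rightarrow> real)"
proof (rule integrableI_nonneg)
  have one: "(\<integral>\<^sup>+x. ennreal (inverse ((1 + \<bar>x\<bar>)\<^sup>2)) \<partial>lborel) < \<infinity>"
  proof -
    have "integrable lborel (\<lambda>x::real. inverse (1 + x\<^sup>2))"
      using integrable_inverse_1_plus_square by (simp add: set_integrable_def)
    then have "(\<integral>\<^sup>+x. ennreal (inverse (1 + x\<^sup>2)) \<partial>lborel) < \<infinity>"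
      by (subst nn_integral_eq_integral) (auto simp: add_nonneg_nonneg)
    moreover have "inverse ((1 + \<bar>x\<bar>)\<^sup>2) \<le> inverse (1 + x\<^sup>2)" for x :: real
      by (intro le_imp_inverse_le) (auto simp: power2_sum add_pos_nonneg)
    ultimately show ?thesis
      by (elim order.strict_trans1[rotated]) (intro nn_integral_mono ennreal_leI)
  qed
  have "(\<integral>\<^sup>+z. ennreal (poly_weight (z::'a)) \<partial>lborel) =
      (\<integral>\<^sup>+z. (\<Prod>b\<in>Basis. ennreal (inverse ((1 + \<bar>z \<bullet> b\<bar>)\<^sup>2))) \<partial>(lborel :: 'a measure))"
    by (simp add: poly_weight_def prod_ennreal)
  also have "\<dots> = (\<Prod>b\<in>(Basis::'a set). (\<integral>\<^sup>+x. ennreal (inverse ((1 + \<bar>x\<bar>)\<^sup>2)) \<partial>lborel))"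
    by (rule nn_integral_lborel_prod) auto
  also have "\<dots> < \<infinity>" using one by (simp add: power_less_top_ennreal)
  finally show "(\<integral>\<^sup>+z. ennreal (poly_weight (z::'a)) \<partial>lborel) < \<infinity>" .
  show "poly_weight \<in> borel_measurable lborel" unfolding poly_weight_def by measurable
qed (auto intro!: AE_I2 less_imp_le poly_weight_pos)

lemma poly_weight_lower:
  fixes z :: "'a::euclidean_space"
  shows "inverse ((1 + norm z) ^ (2 * DIM('a))) \<le> poly_weight z"
proof -
  have "inverse ((1 + norm z) ^ (2 * DIM('a))) = (\<Prod>b\<in>(Basis::'a set). inverse ((1 + norm z)\<^sup>2))"
    by (simp add: power_mult power_inverse)
  also have "\<dots> \<le> poly_weight z"
    unfolding poly_weight_def
    by (intro prod_mono conjI le_imp_inverse_le power_mono add_mono)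
       (auto simp: Basis_le_norm add_pos_nonneg)
  finally show ?thesis .
qed

text \<open>The seminorms of order 0 and 2N together give decay like (1 + |z|)^(-2N), which
  \<open>poly_weight_lower\<close> puts below an integrable function.\<close>

lemma schwartz_integrable:
  fixes f :: "'n::finite ph \<Rightarrow> real"
  assumes f: "schwartz f"
  shows "integrable lborel f"
proof -
  let ?m = "2 * DIM('n ph)"
  from f obtain A B where
    A: "\<And>z. \<bar>norm z ^ ?m * iter_dderiv [] f z\<bar> \<le> A" and B: "\<And>z. \<bar>norm z ^ 0 * iter_dderiv [] f z\<bar> \<le> B"
    using schwartz_bounded by metis
  have bd: "\<bar>f z\<bar> \<le> 2 ^ ?m * (B + A) * poly_weight z" for z
  proof -
    have "(1 + norm z) ^ ?m * \<bar>f z\<bar> \<le> 2 ^ ?m * (1 ^ ?m + norm z ^ ?m) * \<bar>f z\<bar>"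
      by (intro mult_right_mono power_add_le) auto
    also have "\<dots> = 2 ^ ?m * (\<bar>f z\<bar> + \<bar>norm z ^ ?m * iter_dderiv [] f z\<bar>)"
      by (simp add: abs_mult algebra_simps)
    also have "\<dots> \<le> 2 ^ ?m * (B + A)" using A[of z] B[of z] by (intro mult_left_mono add_mono) auto
    finally have "\<bar>f z\<bar> \<le> 2 ^ ?m * (B + A) * inverse ((1 + norm z) ^ ?m)"
      by (simp add: field_simps add_pos_nonneg)
    also have "\<dots> \<le> 2 ^ ?m * (B + A) * poly_weight z"
      using A[of 0] B[of 0] by (intro mult_left_mono poly_weight_lower mult_nonneg_nonneg add_nonneg_nonneg) (auto intro: order_trans[OF abs_ge_zero])
    finally show ?thesis .
  qed
  show ?thesis
  proof (rule Bochner_Integration.integrable_bound)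
    show "integrable lborel (\<lambda>z. 2 ^ ?m * (B + A) * poly_weight (z::'n ph))"
      by (intro integrable_mult_right integrable_poly_weight)
    show "AE z in lborel. norm (f z) \<le> norm (2 ^ ?m * (B + A) * poly_weight z)"
      using bd by (intro AE_I2) (auto intro: order_trans[OF _ abs_ge_self])
    show "f \<in> borel_measurable lborel"
      using f smooth_fun_measurable[of f] by (simp add: schwartz_def)
  qed
qed

section \<open>Oscillatory integrals of bump functions\<close>

text \<open>The phase keeps the Fourier calculus real-valued: cosine and sine transforms are the
  phases 0 and -pi/2, and differentiation in z raises the phase by pi/2. For even g and phase 0 this
  is the inverse transform up to normalization.\<close>

definition osc_int :: "real \<Rightarrow> ('n::finite ph \<Rightarrow> real) \<Rightarrow> 'n ph \<Rightarrow> real" where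
  "osc_int \<alpha> g z = (\<integral>\<xi>. g \<xi> * cos (\<xi> \<bullet> z + \<alpha>) \<partial>lborel)"

lemma osc_integrable: "bump R g \<Longrightarrow> integrable lborel (\<lambda>\<xi>. g \<xi> * cos (\<xi> \<bullet> z + \<alpha>))"
  by (intro bump_mult_integrable continuous_intros) auto

text \<open>First-order Taylor estimate with -sin a written as a phase shift; the left side is the
  real part of e^(ia) (e^(it) - 1 - it).\<close>

lemma cos_remainder: "\<bar>cos (a + t) - cos a - t * cos (a + pi / 2)\<bar> \<le> t\<^sup>2"
proof -
  have "cmod (iexp t - (\<Sum>k \<le> 1. (\<i> * t)^k / fact k)) \<le> \<bar>t\<bar>^(Suc 1) / fact (Suc 1)"
    by (rule iexp_approx1)
  then have 1: "cmod (iexp t - (1 + \<i> * t)) \<le> t\<^sup>2 / 2"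
    by (simp add: power2_eq_square fact_numeral)
  have "cos (a + t) - cos a - t * cos (a + pi / 2) = Re (cis a * (iexp t - (1 + \<i> * t)))"
    by (simp add: cis_conv_exp[symmetric] cos_add sin_add algebra_simps)
  also have "\<bar>\<dots>\<bar> \<le> cmod (cis a * (iexp t - (1 + \<i> * t)))" by (rule abs_Re_le_cmod)
  also have "\<dots> \<le> t\<^sup>2 / 2" using 1 by (simp add: norm_mult)
  also have "\<dots> \<le> t\<^sup>2" by simp
  finally show ?thesis .
qed

lemma osc_int_add:
  assumes "bump R f" "bump R g"
  shows "osc_int \<alpha> (\<lambda>\<xi>. f \<xi> + g \<xi>) z = osc_int \<alpha> f z + osc_int \<alpha> g z"
  unfolding osc_int_def distrib_right
  by (intro Bochner_Integration.integral_add osc_integrable[OF assms(1)] osc_integrable[OF assms(2)])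

lemma abs_osc_int_le: "bump R g \<Longrightarrow> \<bar>osc_int \<alpha> g z\<bar> \<le> (\<integral>\<xi>. \<bar>g \<xi>\<bar> \<partial>lborel)"
  unfolding osc_int_def
  by (rule order_trans[OF integral_abs_bound], rule integral_mono[OF integrable_abs[OF osc_integrable]])
     (auto intro: bump_integrable simp: abs_mult mult_left_le)

text \<open>Differentiation under the integral sign: by \<open>cos_remainder\<close> the error is at
  most |h|^2 times the second moment of |g|, finite because g has bounded support.\<close>

lemma osc_int_has_derivative:
  fixes g :: "'n::finite ph \<Rightarrow> real"
  assumes g: "bump R g"
  shows "(osc_int \<alpha> g has_derivative (\<lambda>h. osc_int (\<alpha> + pi / 2) (\<lambda>\<xi>. (\<xi> \<bullet> h) * g \<xi>) z)) (at z)"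
proof (rule has_derivativeI_sandwich[where e=1])
  note gi = bump_inner_mult[OF g]
  define D where "D h = osc_int (\<alpha> + pi / 2) (\<lambda>\<xi>. (\<xi> \<bullet> h) * g \<xi>) z" for h
  define C where "C = (\<integral>\<xi>. \<bar>g \<xi>\<bar> * (norm \<xi>)\<^sup>2 \<partial>lborel)"
  have i1: "integrable lborel (\<lambda>\<xi>. \<bar>g \<xi>\<bar> * norm \<xi>)"
    using integrable_abs[OF bump_mult_integrable[OF g, of norm]] by (simp add: abs_mult continuous_on_norm_id)
  have i2: "integrable lborel (\<lambda>\<xi>. \<bar>g \<xi>\<bar> * (norm \<xi>)\<^sup>2)"
    using integrable_abs[OF bump_mult_integrable[OF g, of "\<lambda>\<xi>. (norm \<xi>)\<^sup>2"]]
    by (simp add: abs_mult continuous_intros)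
  show "bounded_linear (\<lambda>h. osc_int (\<alpha> + pi / 2) (\<lambda>\<xi>. (\<xi> \<bullet> h) * g \<xi>) z)"
  proof (rule bounded_linear_intro)
    fix x y :: "'n ph" and r :: real
    show "osc_int (\<alpha> + pi / 2) (\<lambda>\<xi>. (\<xi> \<bullet> (x + y)) * g \<xi>) z =
        osc_int (\<alpha> + pi / 2) (\<lambda>\<xi>. (\<xi> \<bullet> x) * g \<xi>) z + osc_int (\<alpha> + pi / 2) (\<lambda>\<xi>. (\<xi> \<bullet> y) * g \<xi>) z"
      unfolding inner_add_right distrib_right by (rule osc_int_add[OF gi gi])
    show "osc_int (\<alpha> + pi / 2) (\<lambda>\<xi>. (\<xi> \<bullet> (r *\<^sub>R x)) * g \<xi>) z =
        r *\<^sub>R osc_int (\<alpha> + pi / 2) (\<lambda>\<xi>. (\<xi> \<bullet> x) * g \<xi>) z"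
      by (simp add: osc_int_def mult.assoc)
    have "\<bar>osc_int (\<alpha> + pi / 2) (\<lambda>\<xi>. (\<xi> \<bullet> x) * g \<xi>) z\<bar> \<le> (\<integral>\<xi>. \<bar>(\<xi> \<bullet> x) * g \<xi>\<bar> \<partial>lborel)"
      by (rule abs_osc_int_le[OF gi])
    also have "\<dots> \<le> (\<integral>\<xi>. norm x * (\<bar>g \<xi>\<bar> * norm \<xi>) \<partial>lborel)"
    proof (rule integral_mono)
      show "\<bar>(\<xi> \<bullet> x) * g \<xi>\<bar> \<le> norm x * (\<bar>g \<xi>\<bar> * norm \<xi>)" for \<xi>
        using mult_right_mono[OF Cauchy_Schwarz_ineq2[of \<xi> x], of "\<bar>g \<xi>\<bar>"]
        by (simp add: abs_mult mult_ac)
    qed (intro integrable_abs bump_integrable[OF gi] integrable_mult_right i1)+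
    finally show "norm (osc_int (\<alpha> + pi / 2) (\<lambda>\<xi>. (\<xi> \<bullet> x) * g \<xi>) z) \<le>
        norm x * (\<integral>\<xi>. \<bar>g \<xi>\<bar> * norm \<xi> \<partial>lborel)"
      by simp
  qed
  show "norm ((osc_int \<alpha> g y - osc_int \<alpha> g z) - osc_int (\<alpha> + pi / 2) (\<lambda>\<xi>. (\<xi> \<bullet> (y - z)) * g \<xi>) z)
      / norm (y - z) \<le> C * norm (y - z)" for y
  proof (cases "y = z")
    case False
    define h where "h = y - z"
    have y: "y = z + h" by (simp add: h_def)
    have "osc_int \<alpha> g y - osc_int \<alpha> g z - osc_int (\<alpha> + pi / 2) (\<lambda>\<xi>. (\<xi> \<bullet> h) * g \<xi>) z =
      (\<integral>\<xi>. g \<xi> * cos (\<xi> \<bullet> y + \<alpha>) - g \<xi> * cos (\<xi> \<bullet> z + \<alpha>) - (\<xi> \<bullet> h) * g \<xi> * cos (\<xi> \<bullet> z + (\<alpha> + pi / 2)) \<partial>lborel)"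
      unfolding osc_int_def using osc_integrable[OF g] osc_integrable[OF gi]
      by (simp add: Bochner_Integration.integral_diff)
    also have "\<bar>\<dots>\<bar> \<le> (\<integral>\<xi>. (norm h)\<^sup>2 * (\<bar>g \<xi>\<bar> * (norm \<xi>)\<^sup>2) \<partial>lborel)"
    proof (rule order_trans[OF integral_abs_bound], rule integral_mono)
      fix \<xi> :: "'n ph"
      let ?a = "\<xi> \<bullet> z + \<alpha>" and ?t = "\<xi> \<bullet> h"
      have "g \<xi> * cos (\<xi> \<bullet> y + \<alpha>) - g \<xi> * cos (\<xi> \<bullet> z + \<alpha>) - (\<xi> \<bullet> h) * g \<xi> * cos (\<xi> \<bullet> z + (\<alpha> + pi / 2))
          = g \<xi> * (cos (?a + ?t) - cos ?a - ?t * cos (?a + pi / 2))"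
        by (simp add: y inner_add_right algebra_simps)
      also have "\<bar>\<dots>\<bar> \<le> \<bar>g \<xi>\<bar> * ?t\<^sup>2"
        unfolding abs_mult[of "g \<xi>"] by (intro mult_left_mono cos_remainder) auto
      also have "\<dots> \<le> \<bar>g \<xi>\<bar> * (norm \<xi> * norm h)\<^sup>2"
        using power_mono[OF Cauchy_Schwarz_ineq2[of \<xi> h], of 2] by (intro mult_left_mono) auto
      finally show "\<bar>g \<xi> * cos (\<xi> \<bullet> y + \<alpha>) - g \<xi> * cos (\<xi> \<bullet> z + \<alpha>) - (\<xi> \<bullet> h) * g \<xi> * cos (\<xi> \<bullet> z + (\<alpha> + pi / 2))\<bar>
          \<le> (norm h)\<^sup>2 * (\<bar>g \<xi>\<bar> * (norm \<xi>)\<^sup>2)"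
        by (simp add: power_mult_distrib mult_ac)
    next
      show "integrable lborel (\<lambda>\<xi>. \<bar>g \<xi> * cos (\<xi> \<bullet> y + \<alpha>) - g \<xi> * cos (\<xi> \<bullet> z + \<alpha>)
          - (\<xi> \<bullet> h) * g \<xi> * cos (\<xi> \<bullet> z + (\<alpha> + pi / 2))\<bar>)"
        by (intro integrable_abs Bochner_Integration.integrable_diff osc_integrable[OF g] osc_integrable[OF gi])
    qed (intro integrable_mult_right i2)
    also have "\<dots> = C * norm h * norm h" by (simp add: C_def power2_eq_square)
    finally show ?thesis using False by (simp add: h_def[symmetric] divide_le_eq)
  qed simp
  show "((\<lambda>y. C * norm (y - z)) \<longlongrightarrow> 0) (at z)"
    by (auto intro!: tendsto_eq_intros)
qed simp

text \<open>Phase and g vary while R is fixed: a derivative only multiplies g by a linear form,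
  which does not enlarge the support.\<close>

lemma osc_int_closed_class:
  assumes "f \<in> {osc_int \<alpha> g | \<alpha> g. bump R g}"
  shows "f differentiable (at z)"
    "(\<lambda>z. frechet_derivative f (at z) v) \<in> {osc_int \<alpha> g | \<alpha> g. bump R g}"
proof -
  from assms obtain \<alpha> g where f: "f = osc_int \<alpha> g" and g: "bump R g" by blast
  show "f differentiable (at z)" using osc_int_has_derivative[OF g] f unfolding differentiable_def by blast
  have "(\<lambda>z. frechet_derivative f (at z) v) = osc_int (\<alpha> + pi / 2) (\<lambda>\<xi>. (\<xi> \<bullet> v) * g \<xi>)"
    unfolding f fun_eq_iff
    by (intro allI frechet_derivative_at[OF osc_int_has_derivative[OF g], symmetric, THEN fun_cong])
  then show "(\<lambda>z. frechet_derivative f (at z) v) \<in> {osc_int \<alpha> g | \<alpha> g. bump R g}"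
    using bump_inner_mult[OF g, of v] by blast
qed

lemma smooth_fun_osc_int: "bump R g \<Longrightarrow> smooth_fun (osc_int \<alpha> g)"
  by (rule closed_class_smooth_fun[where S="{osc_int \<alpha> g | \<alpha> g. bump R g}"])
     (rule osc_int_closed_class(1), assumption, rule osc_int_closed_class(2), assumption, blast)

lemma iter_dderiv_osc_int:
  assumes "bump R g"
  obtains \<alpha>' g' where "bump R g'" "iter_dderiv vs (osc_int \<alpha> g) = osc_int \<alpha>' g'"
proof -
  have "iter_dderiv vs (osc_int \<alpha> g) \<in> {osc_int \<alpha> g | \<alpha> g. bump R g}"
    by (rule closed_class_iter_dderiv, rule osc_int_closed_class(2), assumption) (use assms in blast)
  then show ?thesis using that by blast
qed

lemma integral_lborel_translate:
  fixes f :: "'a::euclidean_space \<Rightarrow> 'b::{banach, second_countable_topology}"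
  assumes [measurable]: "f \<in> borel_measurable borel"
  shows "(\<integral>x. f (c + x) \<partial>lborel) = (\<integral>x. f x \<partial>lborel)"
  by (subst (2) lborel_distr_plus[of c, symmetric]) (simp add: integral_distr)

text \<open>After substitution the shift of g becomes a phase shift by t (b . z), and the addition
  theorem makes the dependence on t elementary.\<close>

lemma osc_int_translate:
  fixes g :: "'n::finite ph \<Rightarrow> real"
  assumes g: "bump R g"
  shows "(\<integral>\<xi>. g (\<xi> + t *\<^sub>R b) * cos (\<xi> \<bullet> z + \<alpha>) \<partial>lborel) =
    cos (t * (b \<bullet> z)) * osc_int \<alpha> g z + sin (t * (b \<bullet> z)) * osc_int (\<alpha> - pi / 2) g z"
proof -
  note [measurable] = smooth_fun_measurable[OF bump_smooth[OF g]]
  let ?c = "b \<bullet> z"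
  have "(\<integral>\<xi>. g (\<xi> + t *\<^sub>R b) * cos (\<xi> \<bullet> z + \<alpha>) \<partial>lborel) =
      (\<integral>\<xi>. (\<lambda>\<eta>. g \<eta> * cos ((\<eta> - t *\<^sub>R b) \<bullet> z + \<alpha>)) (t *\<^sub>R b + \<xi>) \<partial>lborel)"
    by (simp add: add.commute)
  also have "\<dots> = (\<integral>\<eta>. g \<eta> * cos ((\<eta> - t *\<^sub>R b) \<bullet> z + \<alpha>) \<partial>lborel)"
    by (rule integral_lborel_translate) measurable
  also have "\<dots> = (\<integral>\<eta>. cos (t * ?c) * (g \<eta> * cos (\<eta> \<bullet> z + \<alpha>)) +
      sin (t * ?c) * (g \<eta> * cos (\<eta> \<bullet> z + (\<alpha> - pi / 2))) \<partial>lborel)"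
  proof (rule Bochner_Integration.integral_cong[OF refl])
    fix \<eta>
    have "cos ((\<eta> - t *\<^sub>R b) \<bullet> z + \<alpha>) = cos ((\<eta> \<bullet> z + \<alpha>) - t * ?c)"
      by (simp add: inner_diff_left algebra_simps)
    moreover have "cos (\<eta> \<bullet> z + (\<alpha> - pi / 2)) = sin (\<eta> \<bullet> z + \<alpha>)"
      using cos_diff[of "\<eta> \<bullet> z + \<alpha>" "pi / 2"] by (simp add: algebra_simps)
    ultimately show "g \<eta> * cos ((\<eta> - t *\<^sub>R b) \<bullet> z + \<alpha>) = cos (t * ?c) * (g \<eta> * cos (\<eta> \<bullet> z + \<alpha>)) +
      sin (t * ?c) * (g \<eta> * cos (\<eta> \<bullet> z + (\<alpha> - pi / 2)))"
      by (simp add: cos_diff algebra_simps)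
  qed
  finally show ?thesis unfolding osc_int_def
    by (simp add: osc_integrable[OF g])
qed

(* Integration by parts in the frequency variable, obtained by differentiating at t = 0 the effect of the
  translation of g by t b. *)
lemma osc_int_mult_inner:
  fixes g :: "'n::finite ph \<Rightarrow> real"
  assumes g: "bump R g"
  shows "(b \<bullet> z) * osc_int (\<alpha> - pi / 2) g z = osc_int \<alpha> (\<lambda>\<xi>. frechet_derivative g (at \<xi>) b) z"
proof -
  note gm[measurable] = smooth_fun_measurable[OF bump_smooth[OF g]]
  note Dm[measurable] = smooth_fun_measurable[OF bump_smooth[OF bump_dderiv[OF g, of b]]]
  define \<phi> where "\<phi> t = (\<integral>\<xi>. g (\<xi> + t *\<^sub>R b) * cos (\<xi> \<bullet> z + \<alpha>) \<partial>lborel)" for t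
  \<comment> \<open>A sequence of increments, as dominated convergence requires;
    \<open>t n \<le> 1\<close> keeps the supports of all shifted functions in one ball.\<close>
  define t where "t n = inverse (real (Suc n))" for n
  have t: "0 < t n" "t n \<le> 1" for n by (auto simp: t_def field_simps)
  have t0: "t \<longlonglongrightarrow> 0" unfolding t_def by (rule LIMSEQ_inverse_real_of_nat)
  have t_at: "filterlim t (at 0) sequentially"
    using t0 t(1) by (auto simp: filterlim_at less_imp_neq[THEN not_sym] intro!: always_eventually)
  have line: "((\<lambda>s. g (\<xi> + s *\<^sub>R b)) has_real_derivative frechet_derivative g (at (\<xi> + s *\<^sub>R b)) b) (at s)" for \<xi> s
  proof -
    have "((\<lambda>s. g (\<xi> + s *\<^sub>R b)) has_derivative (\<lambda>h. frechet_derivative g (at (\<xi> + s *\<^sub>R b)) (h *\<^sub>R b))) (at s)"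
      by (rule has_derivative_compose[OF _ smooth_fun_has_derivative[OF bump_smooth[OF g]]])
         (auto intro!: derivative_eq_intros)
    moreover have "frechet_derivative g (at (\<xi> + s *\<^sub>R b)) (h *\<^sub>R b) = frechet_derivative g (at (\<xi> + s *\<^sub>R b)) b * h" for h
      using linear_scale[OF linear_frechet_derivative[OF smooth_fun_differentiable[OF bump_smooth[OF g]]]]
      by (simp add: mult.commute)
    ultimately show ?thesis by (simp add: has_field_derivative_def)
  qed
  obtain L where L: "L \<ge> 0" "\<And>\<xi>. \<bar>frechet_derivative g (at \<xi>) b\<bar> \<le> L"
    using bump_bounded[OF bump_dderiv[OF g, of b]] by blast
  \<comment> \<open>Read off from \<open>osc_int_translate\<close>: at t = 0 only the sine term
    contributes. The second computation of the limit passes to the limit under the integral.\<close>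
  have "(\<phi> has_real_derivative (b \<bullet> z) * osc_int (\<alpha> - pi / 2) g z) (at 0)"
    unfolding \<phi>_def osc_int_translate[OF g] by (auto intro!: derivative_eq_intros)
  then have "(\<lambda>n. (\<phi> (0 + t n) - \<phi> 0) / t n) \<longlonglongrightarrow> (b \<bullet> z) * osc_int (\<alpha> - pi / 2) g z"
    unfolding DERIV_def by (rule filterlim_compose[OF _ t_at])
  moreover have "(\<lambda>n. (\<phi> (0 + t n) - \<phi> 0) / t n) \<longlonglongrightarrow> osc_int \<alpha> (\<lambda>\<xi>. frechet_derivative g (at \<xi>) b) z"
  proof -
    have shift: "bump (R + norm b) (\<lambda>\<xi>. g (\<xi> + t n *\<^sub>R b))" for n
      unfolding bump_def
    proof (intro conjI allI impI)
      show "smooth_fun (\<lambda>\<xi>. g (\<xi> + t n *\<^sub>R b))"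
        using smooth_fun_affine[OF bump_smooth[OF g] bounded_linear_ident] by simp
      fix \<xi> :: "'n ph" assume \<xi>: "norm \<xi> > R + norm b"
      have "norm (t n *\<^sub>R b) \<le> norm b" using t[of n] by (simp add: mult_le_cancel_right1 mult_left_le_one_le)
      then have "norm (\<xi> + t n *\<^sub>R b) > R"
        using \<xi> norm_triangle_ineq4[of "\<xi> + t n *\<^sub>R b" "t n *\<^sub>R b"] by simp
      then show "g (\<xi> + t n *\<^sub>R b) = 0" using g by (simp add: bump_def)
    qed
    have q: "(\<phi> (0 + t n) - \<phi> 0) / t n =
        (\<integral>\<xi>. (g (\<xi> + t n *\<^sub>R b) - g \<xi>) / t n * cos (\<xi> \<bullet> z + \<alpha>) \<partial>lborel)" for n
    proof -
      have "\<phi> (0 + t n) - \<phi> 0 = (\<integral>\<xi>. g (\<xi> + t n *\<^sub>R b) * cos (\<xi> \<bullet> z + \<alpha>) - g \<xi> * cos (\<xi> \<bullet> z + \<alpha>) \<partial>lborel)"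
        unfolding \<phi>_def using osc_integrable[OF shift] osc_integrable[OF g] by simp
      also have "\<dots> / t n = (\<integral>\<xi>. (g (\<xi> + t n *\<^sub>R b) * cos (\<xi> \<bullet> z + \<alpha>) - g \<xi> * cos (\<xi> \<bullet> z + \<alpha>)) / t n \<partial>lborel)"
        by (rule integral_divide_zero[symmetric])
      finally show ?thesis by (simp add: left_diff_distrib)
    qed
    show ?thesis unfolding q osc_int_def
    proof (rule integral_dominated_convergence[where w="\<lambda>\<xi>. L * indicator (cball 0 (R + norm b)) \<xi>"])
      show "integrable lborel (\<lambda>\<xi>. L * indicator (cball (0::'n ph) (R + norm b)) \<xi>)"
        by (intro integrable_mult_right integrable_real_indicator)
           (simp_all add: emeasure_bounded_finite[OF bounded_cball, simplified])
      show "AE \<xi> in lborel. (\<lambda>n. (g (\<xi> + t n *\<^sub>R b) - g \<xi>) / t n * cos (\<xi> \<bullet> z + \<alpha>))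
          \<longlonglongrightarrow> frechet_derivative g (at \<xi>) b * cos (\<xi> \<bullet> z + \<alpha>)"
      proof (intro AE_I2 tendsto_intros)
        fix \<xi>
        from line[of \<xi> 0] have "((\<lambda>h. (g (\<xi> + (0 + h) *\<^sub>R b) - g (\<xi> + 0 *\<^sub>R b)) / h)
            \<longlongrightarrow> frechet_derivative g (at (\<xi> + 0 *\<^sub>R b)) b) (at 0)"
          unfolding DERIV_def .
        from filterlim_compose[OF this t_at]
        show "(\<lambda>n. (g (\<xi> + t n *\<^sub>R b) - g \<xi>) / t n) \<longlonglongrightarrow> frechet_derivative g (at \<xi>) b" by simp
      qed
      show "AE \<xi> in lborel. norm ((g (\<xi> + t n *\<^sub>R b) - g \<xi>) / t n * cos (\<xi> \<bullet> z + \<alpha>))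
          \<le> L * indicator (cball 0 (R + norm b)) \<xi>" for n
      proof (intro AE_I2)
        fix \<xi> :: "'n ph"
        show "norm ((g (\<xi> + t n *\<^sub>R b) - g \<xi>) / t n * cos (\<xi> \<bullet> z + \<alpha>)) \<le> L * indicator (cball 0 (R + norm b)) \<xi>"
        proof (cases "norm \<xi> \<le> R + norm b")
          case True
          \<comment> \<open>By the mean value theorem the difference quotient is a directional
            derivative at an intermediate point, hence at most L.\<close>
          obtain s where "g (\<xi> + t n *\<^sub>R b) - g (\<xi> + 0 *\<^sub>R b) = (t n - 0) * frechet_derivative g (at (\<xi> + s *\<^sub>R b)) b"
            using MVT2[OF t(1)[of n], of "\<lambda>s. g (\<xi> + s *\<^sub>R b)" "\<lambda>s. frechet_derivative g (at (\<xi> + s *\<^sub>R b)) b"] line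
            by blast
          then have "(g (\<xi> + t n *\<^sub>R b) - g \<xi>) / t n = frechet_derivative g (at (\<xi> + s *\<^sub>R b)) b"
            using t(1)[of n] by simp
          then have "norm ((g (\<xi> + t n *\<^sub>R b) - g \<xi>) / t n * cos (\<xi> \<bullet> z + \<alpha>)) \<le> L * 1"
            unfolding real_norm_def abs_mult using L by (intro mult_mono) auto
          then show ?thesis using True by simp
        next
          case False
          then have "norm \<xi> > R" "norm \<xi> > R + norm b" using norm_ge_zero[of b] by linarith+
          then have "g \<xi> = 0" "g (\<xi> + t n *\<^sub>R b) = 0" using g shift[of n] by (simp_all add: bump_def)
          then show ?thesis using L(1) by simp
        qed
      qed
    qed measurable
  qed
  ultimately show ?thesis by (rule LIMSEQ_unique)
qed

text \<open>Each factor b . z is traded for a derivative of g along b. The trade shifts the phase,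
  so the induction needs a constant uniform in \<open>\<alpha>\<close>.\<close>

lemma osc_int_inner_decay:
  assumes "bump R g"
  shows "\<exists>C. \<forall>z \<alpha>. \<bar>b \<bullet> z\<bar> ^ k * \<bar>osc_int \<alpha> g z\<bar> \<le> C"
  using assms
proof (induction k arbitrary: g)
  case 0
  then show ?case using abs_osc_int_le[OF 0] by (intro exI[of _ "\<integral>\<xi>. \<bar>g \<xi>\<bar> \<partial>lborel"]) simp
next
  case (Suc k)
  obtain C where C: "\<forall>z \<alpha>. \<bar>b \<bullet> z\<bar> ^ k * \<bar>osc_int \<alpha> (\<lambda>\<xi>. frechet_derivative g (at \<xi>) b) z\<bar> \<le> C"
    using Suc.IH[OF bump_dderiv[OF Suc.prems]] by blast
  have "\<bar>b \<bullet> z\<bar> ^ Suc k * \<bar>osc_int \<alpha> g z\<bar> \<le> C" for z \<alpha>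
  proof -
    have "(b \<bullet> z) * osc_int \<alpha> g z = osc_int (\<alpha> + pi / 2) (\<lambda>\<xi>. frechet_derivative g (at \<xi>) b) z"
      using osc_int_mult_inner[OF Suc.prems, of b z "\<alpha> + pi / 2"] by simp
    then have "\<bar>b \<bullet> z\<bar> ^ Suc k * \<bar>osc_int \<alpha> g z\<bar> =
        \<bar>b \<bullet> z\<bar> ^ k * \<bar>osc_int (\<alpha> + pi / 2) (\<lambda>\<xi>. frechet_derivative g (at \<xi>) b) z\<bar>"
      by (metis abs_mult mult.assoc power_Suc2)
    then show ?thesis using C by metis
  qed
  then show ?case by blast
qed

lemma norm_power_le_sum_inner:
  fixes z :: "'a::euclidean_space"
  shows "norm z ^ k \<le> real DIM('a) ^ k * (\<Sum>b\<in>Basis. \<bar>b \<bullet> z\<bar> ^ k)"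
proof -
  define m where "m = Max ((\<lambda>b. \<bar>z \<bullet> b\<bar>) ` Basis)"
  have "m \<in> (\<lambda>b. \<bar>z \<bullet> b\<bar>) ` Basis" unfolding m_def by (rule Max_in) auto
  then obtain b where b: "b \<in> Basis" "m = \<bar>b \<bullet> z\<bar>" by (auto simp: inner_commute)
  have "norm z \<le> real DIM('a) * m"
    by (rule norm_le_DIM_bound) (auto simp: m_def)
  then have "norm z ^ k \<le> (real DIM('a) * m) ^ k" by (intro power_mono) auto
  also have "\<dots> = real DIM('a) ^ k * \<bar>b \<bullet> z\<bar> ^ k" by (simp add: b power_mult_distrib)
  also have "\<dots> \<le> real DIM('a) ^ k * (\<Sum>b\<in>Basis. \<bar>b \<bullet> z\<bar> ^ k)"
    using b by (intro mult_left_mono member_le_sum) auto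
  finally show ?thesis .
qed

lemma osc_int_decay:
  fixes g :: "'n::finite ph \<Rightarrow> real"
  assumes g: "bump R g"
  shows "\<exists>C. \<forall>z. norm z ^ k * \<bar>osc_int \<alpha> g z\<bar> \<le> C"
proof -
  obtain C where C: "\<And>b z. \<bar>b \<bullet> z\<bar> ^ k * \<bar>osc_int \<alpha> g z\<bar> \<le> C b"
    using osc_int_inner_decay[OF g, of _ k] by metis
  have "norm z ^ k * \<bar>osc_int \<alpha> g z\<bar> \<le> real DIM('n ph) ^ k * (\<Sum>b\<in>Basis. C b)" for z
  proof -
    have "norm z ^ k * \<bar>osc_int \<alpha> g z\<bar> \<le> real DIM('n ph) ^ k * (\<Sum>b\<in>Basis. \<bar>b \<bullet> z\<bar> ^ k) * \<bar>osc_int \<alpha> g z\<bar>"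
      by (intro mult_right_mono norm_power_le_sum_inner) auto
    also have "\<dots> = real DIM('n ph) ^ k * (\<Sum>b\<in>Basis. \<bar>b \<bullet> z\<bar> ^ k * \<bar>osc_int \<alpha> g z\<bar>)"
      by (simp add: sum_distrib_right mult.assoc)
    also have "\<dots> \<le> real DIM('n ph) ^ k * (\<Sum>b\<in>Basis. C b)"
      by (intro mult_left_mono sum_mono C) auto
    finally show ?thesis .
  qed
  then show ?thesis by blast
qed

text \<open>Every iterated derivative is again an oscillatory integral of a bump function, so one
  decay estimate covers all seminorms.\<close>

lemma schwartz_osc_int:
  fixes g :: "'n::finite ph \<Rightarrow> real"
  assumes g: "bump R g"
  shows "schwartz (osc_int \<alpha> g)"
  unfolding schwartz_def
proof (intro conjI allI)
  show "smooth_fun (osc_int \<alpha> g)" by (rule smooth_fun_osc_int[OF g])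
  fix vs :: "'n ph list" and k :: nat
  obtain \<alpha>' g' where g': "bump R g'" "iter_dderiv vs (osc_int \<alpha> g) = osc_int \<alpha>' g'"
    using iter_dderiv_osc_int[OF g] .
  obtain C where "\<forall>z. norm z ^ k * \<bar>osc_int \<alpha>' g' z\<bar> \<le> C" using osc_int_decay[OF g'(1)] by blast
  then show "bounded (range (\<lambda>z. norm z ^ k * iter_dderiv vs (osc_int \<alpha> g) z))"
    unfolding g'(2) by (intro boundedI[where B=C]) (elim imageE, simp add: abs_mult)
qed

section \<open>Fourier inversion\<close>

lemma lborel_integral_affine:
  fixes f :: "'a::euclidean_space \<Rightarrow> 'b::{banach, second_countable_topology}"
  assumes c: "c \<noteq> 0" and [measurable]: "f \<in> borel_measurable borel"
  shows "(\<integral>x. f x \<partial>lborel) = \<bar>c\<bar> ^ DIM('a) *\<^sub>R (\<integral>x. f (t + c *\<^sub>R x) \<partial>lborel)"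
proof -
  have "(\<integral>x. f x \<partial>lborel) = (\<integral>x. f x \<partial>density (distr lborel borel (\<lambda>x. t + c *\<^sub>R x)) (\<lambda>_. ennreal (\<bar>c\<bar> ^ DIM('a))))"
    using lborel_affine[OF c, of t] by (simp add: ennreal_power)
  also have "\<dots> = (\<integral>x. \<bar>c\<bar> ^ DIM('a) *\<^sub>R f (t + c *\<^sub>R x) \<partial>lborel)"
    by (subst integral_density) (auto simp: integral_distr)
  finally show ?thesis by simp
qed

lemma lborel_integrable_affine:
  fixes f :: "'a::euclidean_space \<Rightarrow> 'b::{banach, second_countable_topology}"
  assumes c: "c \<noteq> 0" and f: "integrable lborel f"
  shows "integrable lborel (\<lambda>x. f (t + c *\<^sub>R x))"
proof -
  note [measurable] = borel_measurable_integrable[OF f]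
  have "integrable (density (distr lborel borel (\<lambda>x. t + c *\<^sub>R x)) (\<lambda>_. ennreal (\<bar>c\<bar> ^ DIM('a)))) f"
    using lborel_affine[OF c, of t] f by (simp add: ennreal_power)
  then have i: "integrable lborel (\<lambda>x. \<bar>c\<bar> ^ DIM('a) *\<^sub>R f (t + c *\<^sub>R x))"
    by (subst (asm) integrable_density) (auto simp: integrable_distr_eq)
  have "integrable lborel (\<lambda>x. inverse (\<bar>c\<bar> ^ DIM('a)) *\<^sub>R \<bar>c\<bar> ^ DIM('a) *\<^sub>R f (t + c *\<^sub>R x))"
    by (rule integrable_scaleR_right) (rule i)
  then show ?thesis using c by simp
qed

section \<open>The Gaussian, mollification and the inversion formula\<close>

text \<open>Left without normalization: the value 1 at the origin makes it a convergence factor, and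
  it reproduces itself under the transform up to sqrt(2 pi)^N.\<close>

definition gauss :: "'a::euclidean_space \<Rightarrow> real" where
  "gauss z = exp (- (norm z)\<^sup>2 / 2)"

lemma gauss_0: "gauss 0 = 1"
  by (simp add: gauss_def)

lemma gauss_prod: "gauss z = (\<Prod>b\<in>Basis. exp (- (z \<bullet> b)\<^sup>2 / 2))"
  by (simp add: gauss_def power2_norm_eq_inner euclidean_inner[of z z]
      exp_sum[symmetric] sum_divide_distrib sum_negf flip: power2_eq_square)

text \<open>This is the characteristic function of the standard normal law, cleared of the constant
  in its density.\<close>

lemma gauss_fourier_1d:
  "has_bochner_integral lborel (\<lambda>x. cis (t * x) * of_real (exp (- x\<^sup>2 / 2))) (of_real (sqrt (2 * pi) * exp (- t\<^sup>2 / 2)))"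
proof -
  have int: "integrable std_normal_distribution (\<lambda>x. iexp (t * x))"
    by (rule prob_space.integrable_iexp[OF prob_space_normal_density]) auto
  have "(\<integral>x. iexp (t * x) \<partial>std_normal_distribution) = of_real (exp (- t\<^sup>2 / 2))"
    using fun_cong[OF char_std_normal_distribution, of t] by (simp add: char_def)
  then have "(\<integral>x. std_normal_density x *\<^sub>R iexp (t * x) \<partial>lborel) = of_real (exp (- t\<^sup>2 / 2))"
    by (subst (asm) integral_density) auto
  moreover have "integrable lborel (\<lambda>x. std_normal_density x *\<^sub>R iexp (t * x))"
    using int by (subst (asm) integrable_density) auto
  ultimately have "has_bochner_integral lborel (\<lambda>x. std_normal_density x *\<^sub>R iexp (t * x)) (of_real (exp (- t\<^sup>2 / 2)))"
    by (simp add: has_bochner_integral_iff)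
  from has_bochner_integral_mult_right[OF this, of "of_real (sqrt (2 * pi))"]
  show ?thesis
    by (simp add: std_normal_density_def scaleR_conv_of_real cis_conv_exp mult_ac)
qed

lemma gauss_fourier:
  fixes w :: "'a::euclidean_space"
  shows "integrable lborel (\<lambda>z. cis (w \<bullet> z) * of_real (gauss z))"
    and "(\<integral>z. cis (w \<bullet> z) * of_real (gauss z) \<partial>lborel) = of_real (sqrt (2 * pi) ^ DIM('a) * gauss w)"
proof -
  interpret product_sigma_finite "\<lambda>_::'a. lborel :: real measure"
    by (rule product_sigma_finite.intro) (rule sigma_finite_lborel)
  define h where "h b x = cis ((w \<bullet> b) * x) * complex_of_real (exp (- x\<^sup>2 / 2))" for b :: 'a and x
  have hi: "integrable lborel (h b)" and hI: "(\<integral>x. h b x \<partial>lborel) = of_real (sqrt (2 * pi) * exp (- (w \<bullet> b)\<^sup>2 / 2))" for b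
    using gauss_fourier_1d[of "w \<bullet> b"] by (auto simp: has_bochner_integral_iff h_def[abs_def])
  have cis_sum: "cis (sum f A) = (\<Prod>a\<in>A. cis (f a))" for f :: "'a \<Rightarrow> real" and A
    by (induction A rule: infinite_finite_induct) (auto simp: cis_mult[symmetric])
  have prod: "cis (w \<bullet> z) * of_real (gauss z) = (\<Prod>b\<in>Basis. h b (z \<bullet> b))" for z
    by (simp add: h_def gauss_prod euclidean_inner[of w z] cis_sum prod.distrib)
  have meas[measurable]: "(\<lambda>z. cis (w \<bullet> z) * of_real (gauss z)) \<in> borel_measurable borel"
    unfolding gauss_def cis_conv_exp by (intro borel_measurable_continuous_onI continuous_intros) auto
  have eq: "cis (w \<bullet> (\<Sum>b\<in>Basis. f b *\<^sub>R b)) * of_real (gauss (\<Sum>b\<in>Basis. f b *\<^sub>R b :: 'a)) = (\<Prod>b\<in>Basis. h b (f b))" for f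
    unfolding prod by (intro prod.cong refl) simp
  show "integrable lborel (\<lambda>z. cis (w \<bullet> z) * of_real (gauss z))"
    unfolding lborel_eq[where 'a='a]
    by (subst integrable_distr_eq) (auto simp: eq intro!: product_integrable_prod hi)
  have "(\<integral>z. cis (w \<bullet> z) * of_real (gauss z) \<partial>lborel) = (\<Prod>b\<in>Basis. \<integral>x. h b x \<partial>lborel)"
    unfolding lborel_eq[where 'a='a]
    by (subst integral_distr) (auto simp: eq intro!: product_integral_prod hi)
  then show "(\<integral>z. cis (w \<bullet> z) * of_real (gauss z) \<partial>lborel) = of_real (sqrt (2 * pi) ^ DIM('a) * gauss w)"
    by (simp add: hI prod.distrib gauss_prod[of w])
qed

lemma gauss_integral:
  shows "integrable lborel (gauss :: 'a::euclidean_space \<Rightarrow> real)"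
    and "(\<integral>z. gauss (z::'a) \<partial>lborel) = sqrt (2 * pi) ^ DIM('a)"
proof -
  have "integrable lborel (\<lambda>z::'a. complex_of_real (gauss z))"
    using gauss_fourier(1)[of 0] by simp
  from integrable_Re[OF this] show "integrable lborel (gauss :: 'a \<Rightarrow> real)" by simp
  have "complex_of_real (\<integral>z. gauss z \<partial>(lborel::'a measure)) = of_real (sqrt (2 * pi) ^ DIM('a) * gauss (0::'a))"
    using gauss_fourier(2)[of "0::'a"] by simp
  then show "(\<integral>z. gauss z \<partial>(lborel::'a measure)) = sqrt (2 * pi) ^ DIM('a)"
    unfolding of_real_eq_iff gauss_0 by simp
qed

lemma gauss_bounds: "0 < gauss z" "gauss z \<le> 1"
  by (simp_all add: gauss_def)

lemma abs_gauss [simp]: "\<bar>gauss z\<bar> = gauss z"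
  by (simp add: gauss_def)

lemma borel_measurable_gauss [measurable]: "gauss \<in> borel_measurable borel"
  unfolding gauss_def by measurable

definition osc_transform :: "('a::euclidean_space \<Rightarrow> real) \<Rightarrow> 'a \<Rightarrow> complex" where
  "osc_transform g z = (\<integral>\<eta>. of_real (g \<eta>) * cis (\<eta> \<bullet> z) \<partial>lborel)"

text \<open>The Gaussian makes the double integral absolutely convergent, so Fubini applies. The
  substitutions eta = xi + e u and y = e z have Jacobians that cancel, and the transform of the
  Gaussian turns the z-integral into an average of g around xi at scale e.\<close>

lemma mollified_inversion:
  fixes g :: "'a::euclidean_space \<Rightarrow> real"
  assumes g: "integrable lborel g" and e: "e > 0"
  shows "(\<integral>z. osc_transform g z * cis (- (\<xi> \<bullet> z)) * of_real (gauss (e *\<^sub>R z)) \<partial>lborel) =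
    of_real (sqrt (2 * pi) ^ DIM('a) * (\<integral>u. g (\<xi> + e *\<^sub>R u) * gauss u \<partial>lborel))"
proof -
  note [measurable] = borel_measurable_integrable[OF g]
  let ?N = "DIM('a)"
  define K where "K y u = complex_of_real (g (\<xi> + e *\<^sub>R u)) * cis (u \<bullet> y) * of_real (gauss y)" for y u
  have Km[measurable]: "(\<lambda>p. K (fst p) (snd p)) \<in> borel_measurable (lborel \<Otimes>\<^sub>M lborel)"
    unfolding K_def cis_conv_exp by measurable
  have gi: "integrable lborel (\<lambda>u. g (\<xi> + e *\<^sub>R u))"
    using e by (intro lborel_integrable_affine g) auto
  have Kn: "norm (K y u) = \<bar>g (\<xi> + e *\<^sub>R u)\<bar> * gauss y" for y u
    using gauss_bounds(1)[of y] by (simp add: K_def norm_mult)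
  have inner: "osc_transform g z * cis (- (\<xi> \<bullet> z)) = e ^ ?N *\<^sub>R (\<integral>u. of_real (g (\<xi> + e *\<^sub>R u)) * cis (u \<bullet> (e *\<^sub>R z)) \<partial>lborel)" for z
  proof -
    have "osc_transform g z * cis (- (\<xi> \<bullet> z)) = (\<integral>\<eta>. of_real (g \<eta>) * cis ((\<eta> - \<xi>) \<bullet> z) \<partial>lborel)"
      unfolding osc_transform_def integral_mult_left_zero[symmetric]
      by (simp add: mult.assoc cis_mult inner_diff_left)
    also have "\<dots> = \<bar>e\<bar> ^ ?N *\<^sub>R (\<integral>u. of_real (g (\<xi> + e *\<^sub>R u)) * cis (((\<xi> + e *\<^sub>R u) - \<xi>) \<bullet> z) \<partial>lborel)"
      using e by (intro lborel_integral_affine) (auto simp: cis_conv_exp)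
    finally show ?thesis using e by simp
  qed
  have "(\<integral>z. osc_transform g z * cis (- (\<xi> \<bullet> z)) * of_real (gauss (e *\<^sub>R z)) \<partial>lborel) =
      e ^ ?N *\<^sub>R (\<integral>z. (\<lambda>y. \<integral>u. K y u \<partial>lborel) (e *\<^sub>R z) \<partial>lborel)"
    unfolding inner K_def by simp
  also have "\<dots> = (\<integral>y. (\<integral>u. K y u \<partial>lborel) \<partial>lborel)"
    using e by (subst lborel_integral_affine[of e _ 0]) auto
  also have "\<dots> = (\<integral>u. (\<integral>y. K y u \<partial>lborel) \<partial>lborel)"
  proof (rule lborel_pair.Fubini_integral[where f="\<lambda>u y. K y u"])
    show "integrable (lborel \<Otimes>\<^sub>M lborel) (\<lambda>(u, y). K y u)"
    proof (rule lborel_pair.Fubini_integrable)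
      show "(\<lambda>(u, y). K y u) \<in> borel_measurable (lborel \<Otimes>\<^sub>M lborel)"
        unfolding K_def cis_conv_exp by measurable
      show "integrable lborel (\<lambda>u. \<integral>y. norm (case (u, y) of (u, y) \<Rightarrow> K y u) \<partial>lborel)"
        using gi by (simp add: Kn)
      show "AE u in lborel. integrable lborel (\<lambda>y. case (u, y) of (u, y) \<Rightarrow> K y u)"
      proof (intro AE_I2)
        fix u
        have "integrable lborel (\<lambda>y. complex_of_real (g (\<xi> + e *\<^sub>R u)) * (cis (u \<bullet> y) * of_real (gauss y)))"
          by (intro integrable_mult_right gauss_fourier(1))
        then show "integrable lborel (\<lambda>y. case (u, y) of (u, y) \<Rightarrow> K y u)" by (simp add: K_def mult.assoc)
      qed
    qed
  qed
  also have "\<dots> = (\<integral>u. of_real (sqrt (2 * pi) ^ ?N * (g (\<xi> + e *\<^sub>R u) * gauss u)) \<partial>lborel)"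
    unfolding K_def mult.assoc integral_mult_right_zero gauss_fourier(2) by (simp add: mult_ac)
  also have "\<dots> = of_real (sqrt (2 * pi) ^ ?N * (\<integral>u. g (\<xi> + e *\<^sub>R u) * gauss u \<partial>lborel))"
    by (simp only: integral_complex_of_real integral_mult_right_zero)
  finally show ?thesis .
qed

text \<open>The scale e tends to 0 on both sides of \<open>mollified_inversion\<close>, dominated by
  the norm of the transform and by B times the Gaussian. The transform and the mass of the Gaussian
  each give sqrt(2 pi)^N, together (2 pi)^N.\<close>

theorem fourier_inversion:
  fixes g :: "'a::euclidean_space \<Rightarrow> real"
  assumes g: "integrable lborel g" and cont: "continuous_on UNIV g" and bdd: "\<And>z. \<bar>g z\<bar> \<le> B"
    and F: "integrable lborel (osc_transform g)"
  shows "(\<integral>z. osc_transform g z * cis (- (\<xi> \<bullet> z)) \<partial>lborel) = of_real ((2 * pi) ^ DIM('a) * g \<xi>)"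
proof -
  note [measurable] = borel_measurable_integrable[OF F] borel_measurable_integrable[OF g]
  let ?N = "DIM('a)"
  define e where "e n = inverse (real (Suc n))" for n
  have e: "e n > 0" for n by (simp add: e_def)
  have e0: "e \<longlonglongrightarrow> 0" unfolding e_def by (rule LIMSEQ_inverse_real_of_nat)
  have "(\<lambda>n. \<integral>z. osc_transform g z * cis (- (\<xi> \<bullet> z)) * of_real (gauss (e n *\<^sub>R z)) \<partial>lborel) \<longlonglongrightarrow>
      (\<integral>z. osc_transform g z * cis (- (\<xi> \<bullet> z)) \<partial>lborel)"
  proof (rule integral_dominated_convergence[where w="\<lambda>z. norm (osc_transform g z)"])
    show "AE z in lborel. (\<lambda>n. osc_transform g z * cis (- (\<xi> \<bullet> z)) * of_real (gauss (e n *\<^sub>R z)))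
        \<longlonglongrightarrow> osc_transform g z * cis (- (\<xi> \<bullet> z))"
    proof (intro AE_I2)
      fix z :: 'a
      have "(\<lambda>n. gauss (e n *\<^sub>R z)) \<longlonglongrightarrow> exp (- (norm (0 *\<^sub>R z))\<^sup>2 / 2)"
        unfolding gauss_def by (intro tendsto_intros e0) simp
      then have "(\<lambda>n. osc_transform g z * cis (- (\<xi> \<bullet> z)) * complex_of_real (gauss (e n *\<^sub>R z)))
        \<longlonglongrightarrow> osc_transform g z * cis (- (\<xi> \<bullet> z)) * complex_of_real 1"
        by (intro tendsto_intros) simp
      then show "(\<lambda>n. osc_transform g z * cis (- (\<xi> \<bullet> z)) * complex_of_real (gauss (e n *\<^sub>R z)))
        \<longlonglongrightarrow> osc_transform g z * cis (- (\<xi> \<bullet> z))" by simp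
    qed
    show "AE z in lborel. norm (osc_transform g z * cis (- (\<xi> \<bullet> z)) * of_real (gauss (e n *\<^sub>R z)))
        \<le> norm (osc_transform g z)" for n
      by (intro AE_I2) (simp add: norm_mult mult_left_le gauss_bounds)
  qed (use F in \<open>auto simp: cis_conv_exp\<close>)
  moreover have "(\<lambda>n. complex_of_real (sqrt (2 * pi) ^ ?N * (\<integral>u. g (\<xi> + e n *\<^sub>R u) * gauss u \<partial>lborel))) \<longlonglongrightarrow>
      of_real (sqrt (2 * pi) ^ ?N * (\<integral>u. g \<xi> * gauss (u::'a) \<partial>lborel))"
  proof (intro tendsto_intros integral_dominated_convergence[where w="\<lambda>u. B * gauss u"])
    show "AE u in lborel. (\<lambda>n. g (\<xi> + e n *\<^sub>R u) * gauss u) \<longlonglongrightarrow> g \<xi> * gauss u"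
    proof (intro AE_I2 tendsto_intros)
      fix u :: 'a
      have "(\<lambda>n. \<xi> + e n *\<^sub>R u) \<longlonglongrightarrow> \<xi> + 0 *\<^sub>R u" by (intro tendsto_intros e0)
      then show "(\<lambda>n. g (\<xi> + e n *\<^sub>R u)) \<longlonglongrightarrow> g \<xi>"
        using cont by (intro isCont_tendsto_compose[of \<xi> g]) (auto simp: continuous_on_eq_continuous_at)
    qed
    show "AE u in lborel. norm (g (\<xi> + e n *\<^sub>R u) * gauss u) \<le> B * gauss u" for n
      by (intro AE_I2) (simp add: abs_mult bdd mult_right_mono gauss_bounds(1)[THEN less_imp_le])
  qed (auto intro: gauss_integral)
  ultimately have "(\<integral>z. osc_transform g z * cis (- (\<xi> \<bullet> z)) \<partial>lborel) =
      of_real (sqrt (2 * pi) ^ ?N * (\<integral>u. g \<xi> * gauss (u::'a) \<partial>lborel))"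
    unfolding mollified_inversion[OF g e] by (rule LIMSEQ_unique)
  also have "sqrt (2 * pi) ^ ?N * (\<integral>u. g \<xi> * gauss (u::'a) \<partial>lborel) = (sqrt (2 * pi) * sqrt (2 * pi)) ^ ?N * g \<xi>"
    unfolding integral_mult_right_zero gauss_integral(2) power_mult_distrib by (simp only: mult_ac)
  also have "sqrt (2 * pi) * sqrt (2 * pi) = 2 * pi" by simp
  finally show ?thesis .
qed

section \<open>Littlewood-Paley blocks of the noise\<close>

lemma osc_transform_even:
  fixes g :: "'n::finite ph \<Rightarrow> real"
  assumes g: "bump R g" and even: "\<And>\<xi>. g (- \<xi>) = g \<xi>"
  shows "osc_transform g z = of_real (osc_int 0 g z)"
proof (rule complex_eqI)
  note [measurable] = smooth_fun_measurable[OF bump_smooth[OF g]]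
  have int: "integrable lborel (\<lambda>\<eta>. complex_of_real (g \<eta>) * cis (\<eta> \<bullet> z))"
    by (rule Bochner_Integration.integrable_bound[OF bump_integrable[OF g]])
       (auto simp: norm_mult cis_conv_exp)
  show "Re (osc_transform g z) = Re (of_real (osc_int 0 g z))"
    unfolding osc_transform_def osc_int_def integral_Re[OF int, symmetric] by simp
  \<comment> \<open>The reflection of the variable turns this odd integrand into its negative, so
    the imaginary part vanishes.\<close>
  have "(\<integral>\<eta>. g \<eta> * sin (\<eta> \<bullet> z) \<partial>lborel) = - (\<integral>\<eta>. g \<eta> * sin (\<eta> \<bullet> z) \<partial>lborel)"
    by (subst lborel_integral_affine[of "-1" _ 0]) (simp_all add: even)
  then show "Im (osc_transform g z) = Im (of_real (osc_int 0 g z))"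
    unfolding osc_transform_def integral_Im[OF int, symmetric] by simp
qed

text \<open>The transform of g is Schwartz, hence integrable, which is what the inversion theorem
  asks for. Evenness removes its imaginary part.\<close>

lemma fourier_osc_int:
  fixes g :: "'n::finite ph \<Rightarrow> real"
  assumes g: "bump R g" and even: "\<And>\<xi>. g (- \<xi>) = g \<xi>"
  shows "fourier (osc_int 0 g) \<xi> = of_real ((2 * pi) ^ (2 * CARD('n)) * g \<xi>)"
proof -
  obtain B where "\<And>z. \<bar>g z\<bar> \<le> B" using bump_bounded[OF g] by blast
  moreover have eq: "osc_transform g = (\<lambda>z. of_real (osc_int 0 g z))"
    using osc_transform_even[OF assms] by blast
  moreover have "integrable lborel (osc_transform g)"
    unfolding eq by (rule integrable_of_real[OF schwartz_integrable[OF schwartz_osc_int[OF g]]])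
  ultimately have "(\<integral>z. osc_transform g z * cis (- (\<xi> \<bullet> z)) \<partial>lborel) = of_real ((2 * pi) ^ DIM('n ph) * g \<xi>)"
    by (intro fourier_inversion[OF bump_integrable[OF g] smooth_fun_continuous_on[OF bump_smooth[OF g]]])
  moreover have "DIM('n ph) = 2 * CARD('n)" by simp
  ultimately show ?thesis by (simp only: eq fourier_def)
qed

lemma fourier_translate:
  assumes f: "schwartz f"
  shows "fourier (translate z f) \<xi> = cis (- (\<xi> \<bullet> z)) * fourier f \<xi>"
proof -
  note [measurable] = borel_measurable_integrable[OF schwartz_integrable[OF f]]
  have "fourier (translate z f) \<xi> =
      (\<integral>y. (\<lambda>y. cis (- (\<xi> \<bullet> z)) * (complex_of_real (f y) * cis (- (\<xi> \<bullet> y)))) (- z + y) \<partial>lborel)"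
    unfolding fourier_def translate_def
    by (intro Bochner_Integration.integral_cong) (simp_all add: mult.left_commute cis_mult inner_diff_right)
  also have "\<dots> = (\<integral>y. cis (- (\<xi> \<bullet> z)) * (complex_of_real (f y) * cis (- (\<xi> \<bullet> y))) \<partial>lborel)"
    by (rule integral_lborel_translate) (simp add: cis_conv_exp)
  finally show ?thesis by (simp add: fourier_def)
qed

lemma fourier_integrand_integrable:
  assumes f: "schwartz f"
  shows "integrable lborel (\<lambda>z. complex_of_real (f z) * cis (- (\<xi> \<bullet> z)))"
proof -
  note [measurable] = borel_measurable_integrable[OF schwartz_integrable[OF f]]
  show ?thesis
    by (rule Bochner_Integration.integrable_bound[OF schwartz_integrable[OF f]])
       (auto simp: norm_mult cis_conv_exp)
qed

lemma fourier_lincomb: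
  assumes "schwartz f" "schwartz g"
  shows "fourier (\<lambda>z. a * f z + b * g z) \<xi> = a * fourier f \<xi> + b * fourier g \<xi>"
  unfolding fourier_def of_real_add of_real_mult distrib_right mult.assoc
  using fourier_integrand_integrable[OF assms(1), of \<xi>] fourier_integrand_integrable[OF assms(2), of \<xi>]
  by (subst Bochner_Integration.integral_add) simp_all

section \<open>Anisotropic norm, dilations and dyadic shells\<close>

lemma norm_le_anorm: "norm \<xi> \<le> anorm \<xi> ^ 3 + anorm \<xi>"
proof -
  define a where "a = norm (fst \<xi>) powr (1/3)"
  have a: "a \<ge> 0" "a ^ 3 = norm (fst \<xi>)"
    unfolding a_def by (simp_all add: powr_realpow' powr_powr flip: powr_numeral)
  have "a ^ 3 \<le> anorm \<xi> ^ 3" unfolding anorm_def a_def[symmetric] using a(1) by (intro power_mono) auto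
  moreover have "norm (snd \<xi>) \<le> anorm \<xi>" unfolding anorm_def by simp
  moreover have "norm \<xi> \<le> norm (fst \<xi>) + norm (snd \<xi>)"
    using norm_Pair_le[of "fst \<xi>" "snd \<xi>"] by simp
  ultimately show ?thesis using a by linarith
qed

lemma anorm_nonneg: "0 \<le> anorm \<xi>"
  by (simp add: anorm_def)

lemma anorm_adil: "anorm (adil s \<xi>) = 2 powr s * anorm \<xi>"
  by (simp add: anorm_def adil_def powr_mult powr_powr distrib_left)

lemma bounded_linear_adil: "bounded_linear (adil s)"
  unfolding adil_def
  by (intro bounded_linear_Pair bounded_linear_scaleR_right[THEN bounded_linear_compose]
      bounded_linear_fst bounded_linear_snd)

lemma adil_minus: "adil s (- \<xi>) = - adil s \<xi>"
  by (simp add: adil_def)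

lemma lp_phi_Suc: "lp_phi ch (Suc i) \<xi> = ch (adil (- real (Suc i)) \<xi>) - ch (adil (- real i) \<xi>)"
  by (simp add: lp_phi_def)

locale lp_cutoff =
  fixes chi :: "'n::finite ph \<Rightarrow> real"
  assumes smooth: "smooth_fun chi"
    and sym: "chi (- \<xi>) = chi \<xi>"
    and one: "anorm \<xi> \<le> 1 \<Longrightarrow> chi \<xi> = 1"
    and zero: "anorm \<xi> > 4 / 3 \<Longrightarrow> chi \<xi> = 0"
begin

lemma anorm_adil_neg: "anorm (adil (- real j) \<xi>) = anorm \<xi> / 2 ^ j"
  by (simp add: anorm_adil powr_minus powr_realpow field_simps)

text \<open>Above (4/3) 2^j every dilated cutoff involved vanishes; for j >= 1 and up to 2^(j-1)
  both equal 1 and cancel. The summand 1 in the lower bound admits j = 0, whose support contains the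
  origin. The Euclidean radius comes from \<open>norm_le_anorm\<close> and (4/3)^3 + 4/3 <
  4.\<close>

lemma lp_phi_support:
  assumes "lp_phi chi j \<xi> \<noteq> 0"
  shows "2 ^ j / 2 \<le> 1 + anorm \<xi>" "anorm \<xi> \<le> 4 / 3 * 2 ^ j" "norm \<xi> \<le> 4 * 8 ^ j"
proof -
  show upper: "anorm \<xi> \<le> 4 / 3 * 2 ^ j"
  proof (rule ccontr)
    assume "\<not> ?thesis"
    then have a: "anorm \<xi> > 4 / 3 * 2 ^ j" by simp
    show False
    proof (cases j)
      case 0
      then show False using assms a zero by (simp add: lp_phi_def)
    next
      case (Suc i)
      have "(2::real) ^ i \<le> 2 ^ j" by (simp add: Suc)
      then have "anorm \<xi> > 4 / 3 * 2 ^ i" using a by linarith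
      then have "anorm \<xi> / 2 ^ j > 4 / 3" "anorm \<xi> / 2 ^ i > 4 / 3"
        using a by (simp_all add: less_divide_eq)
      then show False using assms unfolding Suc lp_phi_Suc
        by (simp add: zero anorm_adil_neg del: of_nat_Suc)
    qed
  qed
  show "2 ^ j / 2 \<le> 1 + anorm \<xi>"
  proof (cases j)
    case 0
    then show ?thesis using anorm_nonneg[of \<xi>] by simp
  next
    case (Suc i)
    have "anorm \<xi> > 2 ^ i"
    proof (rule ccontr)
      assume "\<not> ?thesis"
      then have a: "anorm \<xi> \<le> 2 ^ i" by simp
      have "(2::real) ^ i \<le> 2 ^ Suc i" by simp
      then have "anorm \<xi> \<le> 2 ^ Suc i" using a by linarith
      then have "anorm \<xi> / 2 ^ Suc i \<le> 1" "anorm \<xi> / 2 ^ i \<le> 1"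
        using a by (simp_all add: divide_le_eq del: power_Suc)
      then show False using assms unfolding Suc lp_phi_Suc
        by (simp add: one anorm_adil_neg del: of_nat_Suc power_Suc)
    qed
    then show ?thesis by (simp add: Suc)
  qed
  have y: "(2::real) ^ j \<ge> 1" by simp
  have y3: "(8::real) ^ j = (2 ^ j) ^ 3" 
    unfolding power_mult[symmetric] mult.commute[of j] by (simp add: power_mult)
  have "(2::real) ^ j * 1 \<le> 2 ^ j * (2 ^ j)\<^sup>2" using y by (intro mult_left_mono one_le_power) auto
  then have le: "(2::real) ^ j \<le> (2 ^ j) ^ 3" by (simp add: power3_eq_cube power2_eq_square mult.assoc)
  have "norm \<xi> \<le> (4 / 3 * 2 ^ j) ^ 3 + 4 / 3 * 2 ^ j"
    using norm_le_anorm[of \<xi>] power_mono[OF upper anorm_nonneg, of 3] upper by linarith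
  also have "\<dots> = 64 / 27 * (2 ^ j) ^ 3 + 4 / 3 * 2 ^ j" by (simp only: power_mult_distrib) (simp add: power_divide)
  also have "\<dots> \<le> 4 * (2 ^ j) ^ 3"
    using le y by linarith
  finally show "norm \<xi> \<le> 4 * 8 ^ j" by (simp only: y3)
qed

lemma bump_lp_phi: "bump (4 * 8 ^ j) (lp_phi chi j)"
  unfolding bump_def
proof (intro conjI allI impI)
  show "smooth_fun (lp_phi chi j)"
  proof (cases j)
    case 0
    have "lp_phi chi 0 = chi" by (simp add: fun_eq_iff lp_phi_def)
    then show ?thesis using smooth by (simp add: 0)
  next
    case (Suc i)
    have "smooth_fun (\<lambda>\<xi>. chi (adil s \<xi>))" for s
      using smooth_fun_affine[OF smooth bounded_linear_adil, of s 0] by simp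
    then have "smooth_fun (\<lambda>\<xi>. 1 * chi (adil (- real (Suc i)) \<xi>) + (- 1) * chi (adil (- real i) \<xi>))"
      by (intro smooth_fun_lincomb)
    moreover have "lp_phi chi (Suc i) = (\<lambda>\<xi>. 1 * chi (adil (- real (Suc i)) \<xi>) + (- 1) * chi (adil (- real i) \<xi>))"
      by (simp add: fun_eq_iff lp_phi_Suc del: of_nat_Suc)
    ultimately show ?thesis unfolding Suc by (simp only:)
  qed
  fix \<xi> :: "'n ph" assume "norm \<xi> > 4 * 8 ^ j"
  then show "lp_phi chi j \<xi> = 0" using lp_phi_support(3)[of j \<xi>] by force
qed

lemma lp_phi_even: "lp_phi chi j (- \<xi>) = lp_phi chi j \<xi>"
  by (simp add: lp_phi_def adil_minus sym)

lemma lp_phi_bounded: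
  obtains B where "B \<ge> 0" "\<And>j \<xi>. \<bar>lp_phi chi j \<xi>\<bar> \<le> B"
proof -
  have "lp_phi chi 0 = chi" by (simp add: fun_eq_iff lp_phi_def)
  then obtain B where B: "B \<ge> 0" "\<And>z. \<bar>chi z\<bar> \<le> B"
    using bump_bounded[OF bump_lp_phi[of 0]] by metis
  have "\<bar>lp_phi chi j \<xi>\<bar> \<le> B + B" for j \<xi>
  proof (cases j)
    case 0
    then show ?thesis using B(1) B(2)[of \<xi>] by (simp add: lp_phi_def)
  next
    case (Suc i)
    show ?thesis unfolding Suc lp_phi_Suc
      by (rule order_trans[OF abs_triangle_ineq4]) (intro add_mono B(2))
  qed
  then show ?thesis using B(1) by (intro that[of "B + B"]) auto
qed

text \<open>The null summand gives the right side the shape expected by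
  \<open>schwartz_lincomb\<close> and \<open>fourier_lincomb\<close>.\<close>

lemma lp_check_eq: "lp_check chi j = (\<lambda>z. 1 / (2 * pi) ^ (2 * CARD('n)) * osc_int 0 (lp_phi chi j) z + 0 * osc_int 0 (lp_phi chi j) z)"
proof
  fix z
  have "inv_fourier (lp_phi chi j) z = of_real (1 / (2 * pi) ^ (2 * CARD('n))) * osc_transform (lp_phi chi j) z"
    by (simp only: inv_fourier_def osc_transform_def)
  also have "\<dots> = of_real (1 / (2 * pi) ^ (2 * CARD('n)) * osc_int 0 (lp_phi chi j) z)"
    unfolding osc_transform_even[OF bump_lp_phi lp_phi_even] by simp
  finally show "lp_check chi j z = 1 / (2 * pi) ^ (2 * CARD('n)) * osc_int 0 (lp_phi chi j) z + 0 * osc_int 0 (lp_phi chi j) z"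
    by (simp only: lp_check_def Re_complex_of_real)
qed

lemma schwartz_lp_check: "schwartz (lp_check chi j)"
  unfolding lp_check_eq by (intro schwartz_lincomb schwartz_osc_int[OF bump_lp_phi])

lemma fourier_lp_check: "fourier (lp_check chi j) \<xi> = of_real (lp_phi chi j \<xi>)"
proof -
  have "fourier (lp_check chi j) \<xi> = of_real (1 / (2 * pi) ^ (2 * CARD('n))) * of_real ((2 * pi) ^ (2 * CARD('n)) * lp_phi chi j \<xi>)"
    unfolding lp_check_eq
    by (subst fourier_lincomb) (auto simp: fourier_osc_int[OF bump_lp_phi lp_phi_even] intro: schwartz_osc_int[OF bump_lp_phi])
  also have "\<dots> = of_real (lp_phi chi j \<xi>)"
    unfolding of_real_mult[symmetric] by (subst of_real_eq_iff) simp
  finally show ?thesis .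
qed

text \<open>On the support t = (1 + anorm)/2^j lies in [1/4, 4], so |ln t| <= ln 4 and t^ell >=
  4^(-|ell|) for either sign of ell. This converts the moment condition of order ell into the factor
  2^(-j ell).\<close>

lemma lp_phi_weight:
  assumes "lp_phi chi j \<xi> \<noteq> 0"
  shows "1 \<le> 4 powr \<bar>ell\<bar> * 2 powr (- real j * ell) * (1 + anorm \<xi>) powr ell"
proof -
  define t where "t = (1 + anorm \<xi>) / 2 ^ j"
  have y: "(2::real) ^ j \<ge> 1" by simp
  have "1 / 4 * 2 ^ j \<le> 1 + anorm \<xi>" "1 + anorm \<xi> \<le> 4 * 2 ^ j"
    using lp_phi_support(1,2)[OF assms] y by linarith+
  then have t: "1 / 4 \<le> t" "t \<le> 4"
    unfolding t_def by (simp_all add: le_divide_eq divide_le_eq)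
  then have tpos: "t > 0" by simp
  have "\<bar>ln t\<bar> \<le> ln 4"
  proof -
    have "ln t \<le> ln 4" using t tpos by (subst ln_le_cancel_iff) auto
    moreover have "ln (1 / 4) \<le> ln t" using t tpos by (subst ln_le_cancel_iff) auto
    ultimately show ?thesis by (simp add: ln_div)
  qed
  then have "\<bar>ell * ln t\<bar> \<le> \<bar>ell\<bar> * ln 4" unfolding abs_mult by (intro mult_left_mono) auto
  then have "0 \<le> \<bar>ell\<bar> * ln 4 + ell * ln t" by linarith
  then have "1 \<le> 4 powr \<bar>ell\<bar> * t powr ell" using tpos by (simp add: powr_def exp_add[symmetric])
  also have "t powr ell = 2 powr (- real j * ell) * (1 + anorm \<xi>) powr ell"
    using anorm_nonneg[of \<xi>]
    by (simp add: t_def powr_divide powr_powr powr_minus_divide flip: powr_realpow)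
  finally show ?thesis by (simp add: mult.assoc)
qed

end

section \<open>Variance bounds from the spectral measure\<close>

lemma borel_measurable_anorm [measurable]: "(anorm :: 'n::finite ph \<Rightarrow> real) \<in> borel_measurable borel"
proof -
  have "continuous_on UNIV (\<lambda>z::'n ph. norm (fst z) powr (1/3) + norm (snd z))"
    by (intro continuous_intros continuous_on_powr') auto
  then show ?thesis unfolding anorm_def by (rule borel_measurable_continuous_onI)
qed

text \<open>The moment of order ell of the total variation mup + mun.\<close>

definition spec_mass :: "real \<Rightarrow> 'n::finite ph measure \<Rightarrow> 'n ph measure \<Rightarrow> real" where
  "spec_mass ell mup mun = (\<integral>\<zeta>. (1 + anorm \<zeta>) powr ell \<partial>mup) + (\<integral>\<zeta>. (1 + anorm \<zeta>) powr ell \<partial>mun)"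

lemma spec_mass_nonneg: "0 \<le> spec_mass ell mup mun"
  unfolding spec_mass_def by (intro add_nonneg_nonneg integral_nonneg_AE) auto

lemma Re_ipH_le:
  fixes f :: "'n::finite ph \<Rightarrow> real"
  assumes A: "condA ell mup mun" and S: "0 \<le> S"
    and le: "\<And>\<zeta>. (norm (fourier f \<zeta>))\<^sup>2 \<le> S * (1 + anorm \<zeta>) powr ell"
  shows "Re (ipH mup mun f f) \<le> S * spec_mass ell mup mun"
proof -
  let ?h = "\<lambda>\<zeta>. fourier f \<zeta> * cnj (fourier f \<zeta>)"
  let ?w = "\<lambda>\<zeta>::'n ph. (1 + anorm \<zeta>) powr ell"
  have bound: "norm (\<integral>\<zeta>. ?h \<zeta> \<partial>\<nu>) \<le> S * (\<integral>\<zeta>. ?w \<zeta> \<partial>\<nu>)"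
    if s: "sets \<nu> = sets borel" and fin: "(\<integral>\<^sup>+\<zeta>. ennreal (?w \<zeta>) \<partial>\<nu>) < \<infinity>" for \<nu>
  proof -
    have "integrable \<nu> ?w"
      using fin by (intro integrableI_nonneg) (auto simp: measurable_cong_sets[OF s refl])
    then have i: "integrable \<nu> (\<lambda>\<zeta>. S * ?w \<zeta>)" by (rule integrable_mult_right)
    have "norm (\<integral>\<zeta>. ?h \<zeta> \<partial>\<nu>) \<le> (\<integral>\<zeta>. norm (?h \<zeta>) \<partial>\<nu>)" by (rule integral_norm_bound)
    also have "\<dots> \<le> (\<integral>\<zeta>. S * ?w \<zeta> \<partial>\<nu>)"
    \<comment> \<open>This rule asks for integrability of the majorant only, so nothing has to be
      shown about the measurability of \<open>fourier f\<close>.\<close>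
    proof (rule integral_mono'[OF i])
      fix \<zeta> :: "'n ph"
      show "norm (?h \<zeta>) \<le> S * ?w \<zeta>" using le[of \<zeta>] by (simp add: norm_mult power2_eq_square)
      show "0 \<le> S * ?w \<zeta>" using S by simp
    qed
    finally show ?thesis by simp
  qed
  have "Re (ipH mup mun f f) \<le> norm (\<integral>\<zeta>. ?h \<zeta> \<partial>mup) + norm (\<integral>\<zeta>. ?h \<zeta> \<partial>mun)"
    unfolding ipH_def sinteg_def
    by (rule order_trans[OF complex_Re_le_cmod norm_triangle_ineq4])
  also have "\<dots> \<le> S * (\<integral>\<zeta>. ?w \<zeta> \<partial>mup) + S * (\<integral>\<zeta>. ?w \<zeta> \<partial>mun)"
    using A unfolding condA_def by (intro add_mono bound) auto
  finally show ?thesis by (simp add: spec_mass_def distrib_left)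
qed

lemma norm_cis_diff_le: "norm (cis a - cis b) \<le> \<bar>a - b\<bar>"
proof -
  have "cis a - cis b = cis b * (iexp (a - b) - (\<Sum>k \<le> 0. (\<i> * (a - b))^k / fact k))"
    by (simp add: cis_conv_exp exp_diff right_diff_distrib)
  also have "norm \<dots> \<le> \<bar>a - b\<bar> ^ Suc 0 / fact (Suc 0)"
    unfolding norm_mult norm_cis mult_1 by (rule iexp_approx1)
  finally show ?thesis by simp
qed

lemma gaussian_noise_even_moment:
  assumes noise: "gaussian_noise M mup mun U" and f: "schwartz f"
    and V: "Re (ipH mup mun f f) \<le> V"
  shows "(\<integral>\<^sup>+\<omega>. ennreal (\<bar>U f \<omega>\<bar> ^ (2 * r)) \<partial>M) \<le> ennreal (fact (2 * r) / (2 ^ r * fact r) * V ^ r)"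
proof -
  from noise f have M: "prob_space M" and X: "centered_gaussian M (U f)"
    and cov: "complex_of_real (\<integral>\<omega>. U f \<omega> * U f \<omega> \<partial>M) = ipH mup mun f f"
    unfolding gaussian_noise_def by blast+
  have "(\<integral>\<omega>. U f \<omega> * U f \<omega> \<partial>M) \<le> V"
    using V cov by (metis Re_complex_of_real)
  moreover have "0 \<le> (\<integral>\<omega>. U f \<omega> * U f \<omega> \<partial>M)" by (rule integral_nonneg_AE) auto
  ultimately have "(\<integral>\<omega>. U f \<omega> * U f \<omega> \<partial>M) ^ r \<le> V ^ r" by (intro power_mono)
  then have "fact (2 * r) / (2 ^ r * fact r) * (\<integral>\<omega>. U f \<omega> * U f \<omega> \<partial>M) ^ r \<le> fact (2 * r) / (2 ^ r * fact r) * V ^ r"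
    by (intro mult_left_mono) auto
  then show ?thesis
    using centered_gaussian_even_moment[OF M X, of r] by (simp add: power_even_abs ennreal_leI)
qed

context lp_cutoff
begin

definition block :: "(('n ph \<Rightarrow> real) \<Rightarrow> 'w \<Rightarrow> real) \<Rightarrow> nat \<Rightarrow> 'n ph \<Rightarrow> 'w \<Rightarrow> real" where
  "block U j z = U (translate z (lp_check chi j))"

lemma fourier_block:
  "fourier (translate z (lp_check chi j)) \<zeta> = cis (- (\<zeta> \<bullet> z)) * of_real (lp_phi chi j \<zeta>)"
  by (simp add: fourier_translate[OF schwartz_lp_check] fourier_lp_check)

lemma lp_phi_square_le:
  assumes B: "\<And>j \<xi>. \<bar>lp_phi chi j \<xi>\<bar> \<le> B"
  shows "(lp_phi chi j \<zeta>)\<^sup>2 \<le> B\<^sup>2 * (4 powr \<bar>ell\<bar> * 2 powr (- real j * ell)) * (1 + anorm \<zeta>) powr ell"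
proof (cases "lp_phi chi j \<zeta> = 0")
  case False
  have "(lp_phi chi j \<zeta>)\<^sup>2 \<le> B\<^sup>2"
    using power_mono[OF B[of j \<zeta>] abs_ge_zero, of 2] unfolding power2_abs .
  also have "B\<^sup>2 * 1 \<le> B\<^sup>2 * (4 powr \<bar>ell\<bar> * 2 powr (- real j * ell) * (1 + anorm \<zeta>) powr ell)"
    by (intro mult_left_mono lp_phi_weight False) auto
  finally show ?thesis by (simp add: mult.assoc)
qed simp

text \<open>Translation multiplies the transform by a unimodular factor, so the bound on the
  variance is the same at every z. For an increment the factor is a difference of two characters, at
  most |zeta| |z - w|, hence at most 4 8^j |z - w| on the support. This dictates the mesh 1/(4
  8^j).\<close>

lemma block_moments:
  fixes U :: "('n ph \<Rightarrow> real) \<Rightarrow> 'w \<Rightarrow> real"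
  assumes A: "condA ell mup mun" and noise: "gaussian_noise M mup mun U"
    and B: "\<And>j \<xi>. \<bar>lp_phi chi j \<xi>\<bar> \<le> B"
  defines "V \<equiv> \<lambda>j. B\<^sup>2 * (4 powr \<bar>ell\<bar> * 2 powr (- real j * ell)) * spec_mass ell mup mun"
  shows "(\<integral>\<^sup>+\<omega>. ennreal (\<bar>block U j z \<omega>\<bar> ^ (2 * r)) \<partial>M)
      \<le> ennreal (fact (2 * r) / (2 ^ r * fact r) * V j ^ r)" (is ?th1)
    and "(\<integral>\<^sup>+\<omega>. ennreal (\<bar>block U j z \<omega> - block U j w \<omega>\<bar> ^ (2 * r)) \<partial>M)
      \<le> ennreal (fact (2 * r) / (2 ^ r * fact r) * V j ^ r * (norm (z - w) / (1 / (4 * 8 ^ j))) ^ (2 * r))" (is ?th2)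
proof -
  let ?S = "B\<^sup>2 * (4 powr \<bar>ell\<bar> * 2 powr (- real j * ell))"
  let ?f = "\<lambda>z. translate z (lp_check chi j)"
  have sf: "schwartz (?f z)" for z by (rule schwartz_translate[OF schwartz_lp_check])
  have "Re (ipH mup mun (?f z) (?f z)) \<le> V j"
    unfolding V_def
  proof (rule Re_ipH_le[OF A])
    show "(norm (fourier (?f z) \<zeta>))\<^sup>2 \<le> ?S * (1 + anorm \<zeta>) powr ell" for \<zeta>
      using lp_phi_square_le[OF B, of j \<zeta> ell] by (simp add: fourier_block norm_mult)
  qed auto
  then show ?th1 unfolding block_def by (rule gaussian_noise_even_moment[OF noise sf])
  define D where "D = norm (z - w) / (1 / (4 * 8 ^ j))"
  define g where "g = (\<lambda>y. 1 * ?f z y + (- 1) * ?f w y)"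
  have sg: "schwartz g" unfolding g_def by (intro schwartz_lincomb sf)
  have "Re (ipH mup mun g g) \<le> (?S * D\<^sup>2) * spec_mass ell mup mun"
  proof (rule Re_ipH_le[OF A])
    fix \<zeta> :: "'n ph"
    have fg: "fourier g \<zeta> = (cis (- (\<zeta> \<bullet> z)) - cis (- (\<zeta> \<bullet> w))) * of_real (lp_phi chi j \<zeta>)"
      unfolding g_def by (subst fourier_lincomb[OF sf sf]) (simp add: fourier_block left_diff_distrib)
    show "(norm (fourier g \<zeta>))\<^sup>2 \<le> ?S * D\<^sup>2 * (1 + anorm \<zeta>) powr ell"
    proof (cases "lp_phi chi j \<zeta> = 0")
      case False
      have "norm (cis (- (\<zeta> \<bullet> z)) - cis (- (\<zeta> \<bullet> w))) \<le> \<bar>- (\<zeta> \<bullet> z) - - (\<zeta> \<bullet> w)\<bar>"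
        by (rule norm_cis_diff_le)
      also have "\<dots> = \<bar>\<zeta> \<bullet> (z - w)\<bar>" by (simp add: inner_diff_right abs_minus_commute)
      also have "\<dots> \<le> norm \<zeta> * norm (z - w)" by (rule Cauchy_Schwarz_ineq2)
      also have "\<dots> \<le> 4 * 8 ^ j * norm (z - w)"
        by (intro mult_right_mono lp_phi_support(3)[OF False]) auto
      also have "\<dots> = D" by (simp add: D_def)
      finally have d: "norm (cis (- (\<zeta> \<bullet> z)) - cis (- (\<zeta> \<bullet> w))) \<le> D" .
      have "(norm (fourier g \<zeta>))\<^sup>2 = (norm (cis (- (\<zeta> \<bullet> z)) - cis (- (\<zeta> \<bullet> w))))\<^sup>2 * (lp_phi chi j \<zeta>)\<^sup>2"
        by (simp add: fg norm_mult power_mult_distrib)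
      also have "\<dots> \<le> D\<^sup>2 * (?S * (1 + anorm \<zeta>) powr ell)"
        by (intro mult_mono power_mono d lp_phi_square_le[OF B]) auto
      finally show ?thesis by (simp add: mult_ac)
    qed (simp add: fg)
  qed auto
  then have "Re (ipH mup mun g g) \<le> V j * D\<^sup>2" by (simp add: V_def mult_ac)
  from gaussian_noise_even_moment[OF noise sg this, of r]
  have "(\<integral>\<^sup>+\<omega>. ennreal (\<bar>U g \<omega>\<bar> ^ (2 * r)) \<partial>M) \<le> ennreal (fact (2 * r) / (2 ^ r * fact r) * V j ^ r * D ^ (2 * r))"
    by (simp add: power_mult_distrib power_mult mult.assoc)
  \<comment> \<open>The null set depends on z and w, which is harmless for a moment at a fixed
    pair.\<close>
  moreover have "AE \<omega> in M. U g \<omega> = 1 * U (?f z) \<omega> + (- 1) * U (?f w) \<omega>"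
    using noise sf unfolding gaussian_noise_def g_def by blast
  then have "(\<integral>\<^sup>+\<omega>. ennreal (\<bar>block U j z \<omega> - block U j w \<omega>\<bar> ^ (2 * r)) \<partial>M) = (\<integral>\<^sup>+\<omega>. ennreal (\<bar>U g \<omega>\<bar> ^ (2 * r)) \<partial>M)"
    by (intro nn_integral_cong_AE) (auto simp: block_def)
  ultimately show ?th2 by (simp add: D_def)
qed

end

section \<open>Summation over the blocks\<close>

lemma poly_weight_lower_square:
  fixes z :: "'a::euclidean_space"
  shows "inverse ((1 + (norm z)\<^sup>2) ^ DIM('a)) \<le> 2 ^ DIM('a) * poly_weight z"
proof -
  have "inverse ((1 + (norm z)\<^sup>2) ^ DIM('a)) = (\<Prod>b\<in>(Basis::'a set). inverse (1 + (norm z)\<^sup>2))"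
    by (simp add: power_inverse)
  also have "\<dots> \<le> (\<Prod>b\<in>(Basis::'a set). 2 * inverse ((1 + \<bar>z \<bullet> b\<bar>)\<^sup>2))"
  proof (intro prod_mono conjI)
    fix b :: 'a assume b: "b \<in> Basis"
    have "0 \<le> (1 - \<bar>z \<bullet> b\<bar>)\<^sup>2" by simp
    moreover have "\<bar>z \<bullet> b\<bar>\<^sup>2 \<le> (norm z)\<^sup>2" by (intro power_mono Basis_le_norm b) auto
    ultimately have "(1 + \<bar>z \<bullet> b\<bar>)\<^sup>2 \<le> 2 * (1 + (norm z)\<^sup>2)"
      by (simp add: power2_eq_square algebra_simps)
    moreover have "0 < (1 + \<bar>z \<bullet> b\<bar>)\<^sup>2" "0 < 1 + (norm z)\<^sup>2" by (auto simp: add_pos_nonneg)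
    ultimately show "inverse (1 + (norm z)\<^sup>2) \<le> 2 * inverse ((1 + \<bar>z \<bullet> b\<bar>)\<^sup>2)"
      by (simp add: field_simps)
  qed (simp add: add_nonneg_nonneg)
  finally show ?thesis by (simp add: poly_weight_def prod.distrib)
qed

text \<open>With a = (1+|x|^2)^(1/3) and t = |v|^2, expanding (a + 1 + t)^3 gives a^3 + t plus
  nonnegative terms. So the base of \<open>rho\<close> is at least (1+|z|^2)^(1/3), which turns the
  exponent -kappa/2 into -kappa/6.\<close>

lemma rho_le:
  fixes z :: "'n::finite ph"
  assumes k: "0 \<le> \<kappa>"
  shows "rho \<kappa> z \<le> (1 + (norm z)\<^sup>2) powr (- \<kappa> / 6)"
proof -
  define a where "a = (1 + (norm (fst z))\<^sup>2) powr (1/3)"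
  define t where "t = (norm (snd z))\<^sup>2"
  have base: "1 + (norm (fst z))\<^sup>2 > 0" by (simp add: add_pos_nonneg)
  have a: "a > 0" "a ^ 3 = 1 + (norm (fst z))\<^sup>2"
    unfolding a_def using base by (simp_all add: powr_powr flip: powr_numeral)
  have t: "t \<ge> 0" by (simp add: t_def)
  have n: "(norm z)\<^sup>2 = (norm (fst z))\<^sup>2 + t"
    by (cases z) (simp add: t_def norm_Pair)
  have "(a + 1 + t) ^ 3 = a ^ 3 + t + (1 + 3 * a\<^sup>2 * (1 + t) + 3 * a * (1 + t)\<^sup>2 + 2 * t + 3 * t\<^sup>2 + t ^ 3)"
    by (simp add: power3_eq_cube power2_eq_square algebra_simps)
  moreover have "0 \<le> 1 + 3 * a\<^sup>2 * (1 + t) + 3 * a * (1 + t)\<^sup>2 + 2 * t + 3 * t\<^sup>2 + t ^ 3"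
    using a(1) t by (intro add_nonneg_nonneg mult_nonneg_nonneg) auto
  ultimately have "1 + (norm z)\<^sup>2 \<le> (a + 1 + t) ^ 3" by (simp add: n a)
  then have "(1 + (norm z)\<^sup>2) powr (1/3) \<le> ((a + 1 + t) ^ 3) powr (1/3)"
    by (intro powr_mono2) auto
  also have "\<dots> = a + 1 + t" using a(1) t by (simp add: powr_powr flip: powr_numeral)
  finally have "(a + 1 + t) powr (- \<kappa> / 2) \<le> ((1 + (norm z)\<^sup>2) powr (1/3)) powr (- \<kappa> / 2)"
    using k by (intro powr_mono2') (auto simp: add_pos_nonneg less_imp_neq[THEN not_sym])
  then show ?thesis by (simp add: rho_def a_def t_def powr_powr)
qed

text \<open>The condition on q says that kappa q/6 is at least the dimension, the exponent at which
  \<open>poly_weight_lower_square\<close> applies.\<close>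

lemma rho_power_le:
  fixes z :: "'n::finite ph"
  assumes k: "0 \<le> \<kappa>" and q: "6 * real DIM('n ph) \<le> \<kappa> * real q"
  shows "rho \<kappa> z ^ q \<le> 2 ^ DIM('n ph) * poly_weight z"
proof -
  let ?b = "1 + (norm z)\<^sup>2"
  have b: "?b \<ge> 1" by simp
  have "rho \<kappa> z ^ q \<le> (?b powr (- \<kappa> / 6)) ^ q"
    by (intro power_mono rho_le k) (simp add: rho_def)
  also have "\<dots> = ?b powr (- (\<kappa> * real q / 6))"
    using b by (subst powr_power) (auto simp: mult_ac add_pos_nonneg less_imp_neq[THEN not_sym])
  also have "\<dots> \<le> ?b powr (- real DIM('n ph))"
    using q b by (intro powr_mono) auto
  also have "\<dots> = inverse (?b ^ DIM('n ph))"
    using b by (simp only: powr_minus) (subst powr_realpow, auto simp: add_pos_nonneg)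
  also have "\<dots> \<le> 2 ^ DIM('n ph) * poly_weight z" by (rule poly_weight_lower_square)
  finally show ?thesis .
qed

section \<open>Measurability of the norm\<close>

text \<open>Where f exceeds the supremum over D is an open set; if nonempty, it would meet D. With D
  countable this makes the supremum over all points measurable in \<open>\<omega>\<close>.\<close>

lemma SUP_eq_SUP_dense:
  fixes f :: "'a::topological_space \<Rightarrow> ennreal"
  assumes f: "continuous_on UNIV f" and D: "\<And>X. open X \<Longrightarrow> X \<noteq> {} \<Longrightarrow> \<exists>d\<in>D. d \<in> X"
  shows "(SUP z. f z) = (SUP z\<in>D. f z)"
proof (rule antisym)
  show "(SUP z. f z) \<le> (SUP z\<in>D. f z)"
  proof (rule SUP_least, rule ccontr)
    fix z assume "\<not> f z \<le> (SUP z\<in>D. f z)"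
    moreover have "open {x. (SUP z\<in>D. f z) < f x}"
      by (intro open_Collect_less continuous_on_const f)
    ultimately obtain d where "d \<in> D" "(SUP z\<in>D. f z) < f d"
      using D[of "{x. (SUP z\<in>D. f z) < f x}"] by (auto simp: not_le)
    then show False using SUP_upper[of d D f] by (simp add: leD)
  qed
qed (rule SUP_subset_mono, auto)

lemma continuous_on_rho: "continuous_on UNIV (rho \<kappa> :: 'n::finite ph \<Rightarrow> real)"
proof -
  have "(1 + norm (fst z)^2) powr (1/3) + 1 + norm (snd z)^2 > 0" for z :: "'n ph"
    by (intro add_nonneg_pos add_pos_nonneg) auto
  then show ?thesis unfolding rho_def
    by (intro continuous_intros continuous_on_powr') (auto simp: add_nonneg_nonneg less_imp_neq[THEN not_sym])
qed

lemma borel_measurable_Cnorm: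
  fixes U :: "('n::finite ph \<Rightarrow> real) \<Rightarrow> 'w \<Rightarrow> real"
  assumes meas[measurable]: "\<And>j z. U (translate z (lp_check ch j)) \<in> borel_measurable M"
    and cont: "\<And>j \<omega>. \<omega> \<in> space M \<Longrightarrow> continuous_on UNIV (\<lambda>z. U (translate z (lp_check ch j)) \<omega>)"
  shows "Cnorm ch \<beta> \<kappa> U \<in> borel_measurable M"
proof -
  obtain D :: "'n ph set" where D: "countable D" "\<And>X. open X \<Longrightarrow> X \<noteq> {} \<Longrightarrow> \<exists>d\<in>D. d \<in> X"
    using countable_dense_exists by blast
  have "(\<lambda>\<omega>. SUP j. SUP z\<in>D. ennreal (2 powr (real j * \<beta>) * rho \<kappa> z * \<bar>U (translate z (lp_check ch j)) \<omega>\<bar>))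
      \<in> borel_measurable M"
    using D(1) by (intro borel_measurable_SUP) auto
  moreover have "Cnorm ch \<beta> \<kappa> U \<omega> =
      (SUP j. SUP z\<in>D. ennreal (2 powr (real j * \<beta>) * rho \<kappa> z * \<bar>U (translate z (lp_check ch j)) \<omega>\<bar>))"
    if "\<omega> \<in> space M" for \<omega>
    unfolding Cnorm_def
    by (intro SUP_cong refl SUP_eq_SUP_dense D(2) continuous_on_ennreal continuous_on_mult
        continuous_on_const continuous_on_rho continuous_on_rabs cont that)
  ultimately show ?thesis by (simp cong: measurable_cong)
qed

text \<open>Two factors 2/3 give 4/9 < 1/2, so they pay for one factor 2.\<close>

lemma dyadic_decay_exponent:
  fixes N q :: nat
  assumes "2 * N + 2 \<le> q"
  shows "2 ^ N * (2 / 3) ^ q \<le> (1 / 2 :: real)"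
proof -
  have "(2 / 3 :: real) ^ q \<le> (2 / 3) ^ (2 * (N + 1))"
    using assms by (intro power_decreasing) auto
  also have "\<dots> = (4 / 9) ^ (N + 1)" by (simp only: power_mult) (simp add: power_divide)
  also have "\<dots> \<le> (1 / 2) ^ (N + 1)" by (intro power_mono) auto
  finally have "2 ^ N * (2 / 3 :: real) ^ q \<le> 2 ^ N * (1 / 2) ^ (N + 1)" by (intro mult_left_mono) auto
  also have "\<dots> = 1 / 2" by (simp add: power_divide)
  finally show ?thesis .
qed

text \<open>One integrable variable dominates the q-th powers for all j and z at once, with q = 2r
  and N = \<open>DIM('n ph)\<close>. The conditions on r serve, in order, the chaining sum over
  levels, the domination of rho^q by the polynomial weight, and the sum over blocks.\<close>

lemma (in lp_cutoff) weighted_moment_dominated: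
  fixes U :: "('n ph \<Rightarrow> real) \<Rightarrow> 'w \<Rightarrow> real"
  assumes A: "condA ell mup mun" and noise: "gaussian_noise M mup mun U"
    and k: "0 \<le> \<kappa>" and r: "2 * DIM('n ph) + 2 \<le> 2 * r" "6 * real DIM('n ph) \<le> \<kappa> * real (2 * r)"
      "3 * real DIM('n ph) + 1 \<le> (ell / 2 - \<beta>) * real (2 * r)"
  obtains S where "S \<in> borel_measurable M" "(\<integral>\<^sup>+\<omega>. S \<omega> \<partial>M) < \<infinity>"
    "\<And>j z \<omega>. \<omega> \<in> space M \<Longrightarrow>
      ennreal ((2 powr (real j * \<beta>) * rho \<kappa> z * \<bar>U (translate z (lp_check chi j)) \<omega>\<bar>) ^ (2 * r)) \<le> S \<omega>"
proof -
  let ?N = "DIM('n ph)" and ?q = "2 * r"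
  obtain B where B: "B \<ge> 0" "\<And>j \<xi>. \<bar>lp_phi chi j \<xi>\<bar> \<le> B" using lp_phi_bounded by metis
  define h where "h j = (1 / (4 * 8 ^ j) :: real)" for j :: nat
  have h: "0 < h j" "h j \<le> 1" for j
  proof -
    have "1 \<le> 4 * (8::real) ^ j" using one_le_power[of "8::real" j] by linarith
    then show "0 < h j" "h j \<le> 1" by (auto simp: h_def divide_le_eq)
  qed
  define K where "K = B\<^sup>2 * 4 powr \<bar>ell\<bar> * spec_mass ell mup mun"
  have K: "K \<ge> 0" by (simp add: K_def spec_mass_nonneg)
  define G where "G j = fact ?q / (2 ^ r * fact r) * (K * 2 powr (- real j * ell)) ^ r" for j :: nat
  have G: "G j \<ge> 0" for j using K by (simp add: G_def)
  have sch: "schwartz (translate z (lp_check chi j))" for z j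
    by (rule schwartz_translate[OF schwartz_lp_check])
  have meas: "block U j z \<in> borel_measurable M" for j z
    using noise sch[of z j] unfolding gaussian_noise_def centered_gaussian_def block_def by blast
  note cbm[measurable] = borel_measurable_chain_bound(2)[of "block U _" M, OF meas]
  \<comment> \<open>The q-th power of the Besov factor 2^(j beta), with the constant of
    \<open>rho_power_le\<close>.\<close>
  define a where "a j = 2 powr (real j * \<beta> * real ?q) * 2 ^ ?N" for j :: nat
  define S where "S \<omega> = (\<Sum>j. ennreal (a j) * chain_bound (h j) ?q (\<lambda>z. block U j z \<omega>))" for \<omega>
  show ?thesis
  proof (rule that[of S])
    show "S \<in> borel_measurable M" unfolding S_def by measurable
    \<comment> \<open>All factors that do not depend on j; \<open>64 ^ ?N\<close> is what (16 / h
      j)^N leaves once its growth 2^(3jN) is split off.\<close>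
    define C where "C = 2 ^ ?N * (fact ?q / (2 ^ r * fact r) * K ^ r * (2 * (8 * real ?N) ^ ?q * 64 ^ ?N))"
    have C: "C \<ge> 0" using K by (simp add: C_def)
    have level: "ennreal (a j) * (\<integral>\<^sup>+\<omega>. chain_bound (h j) ?q (\<lambda>z. block U j z \<omega>) \<partial>M) \<le> ennreal (C * (1/2) ^ j)" for j
    proof -
      have Gb: "(\<integral>\<^sup>+\<omega>. ennreal (\<bar>block U j z \<omega>\<bar> ^ ?q) \<partial>M) \<le> ennreal (G j)" for z
        using block_moments(1)[OF A noise B(2), where j=j and z=z and r=r] by (simp only: G_def K_def mult_ac)
      have Gi: "(\<integral>\<^sup>+\<omega>. ennreal (\<bar>block U j z \<omega> - block U j w \<omega>\<bar> ^ ?q) \<partial>M) \<le>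
          ennreal (G j * (norm (z - w) / h j) ^ ?q)" for z w
        using block_moments(2)[OF A noise B(2), where j=j and z=z and w=w and r=r] by (simp only: G_def K_def h_def mult_ac)
      have "(\<integral>\<^sup>+\<omega>. chain_bound (h j) ?q (\<lambda>z. block U j z \<omega>) \<partial>M) \<le>
          ennreal (G j * (2 * (8 * real ?N) ^ ?q * (16 / h j) ^ ?N))"
        by (rule nn_integral_chain_bound_le[OF h meas G Gb Gi dyadic_decay_exponent[OF r(1)]])
      then have "ennreal (a j) * (\<integral>\<^sup>+\<omega>. chain_bound (h j) ?q (\<lambda>z. block U j z \<omega>) \<partial>M) \<le>
          ennreal (a j) * ennreal (G j * (2 * (8 * real ?N) ^ ?q * (16 / h j) ^ ?N))"
        by (intro mult_left_mono) auto
      also have "\<dots> = ennreal (a j * (G j * (2 * (8 * real ?N) ^ ?q * (16 / h j) ^ ?N)))"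
        by (simp add: ennreal_mult' a_def)
      also have "\<dots> \<le> ennreal (C * (1/2) ^ j)"
      proof (rule ennreal_leI)
        have e1: "(16 / h j) ^ ?N = 64 ^ ?N * 2 powr (real j * 3 * real ?N)"
        proof -
          have "(8::real) ^ j = 2 powr (real j * 3)"
            by (simp add: powr_powr[symmetric] powr_realpow mult.commute[of _ 3])
          then have "16 / h j = 64 * 2 powr (real j * 3)" by (simp add: h_def)
          then show ?thesis by (simp add: power_mult_distrib powr_power mult_ac)
        qed
        have e2: "(K * 2 powr (- real j * ell)) ^ r = K ^ r * 2 powr (- real j * ell * real r)"
          by (simp add: power_mult_distrib powr_power mult_ac)
        have "a j * (G j * (2 * (8 * real ?N) ^ ?q * (16 / h j) ^ ?N)) =
            C * (2 powr (real j * \<beta> * real ?q) * (2 powr (- real j * ell * real r) * 2 powr (real j * 3 * real ?N)))"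
          unfolding a_def G_def e1 e2 C_def by (simp only: mult_ac)
        \<comment> \<open>Norm, variance and lattice density meet here; ell r = (ell/2) q, so the
          gap ell/2 - beta appears multiplied by q and overcomes 3N.\<close>
        also have "2 powr (real j * \<beta> * real ?q) * (2 powr (- real j * ell * real r) * 2 powr (real j * 3 * real ?N)) =
            2 powr (real j * (3 * real ?N - (ell / 2 - \<beta>) * real ?q))"
          unfolding powr_add[symmetric] by (simp add: algebra_simps)
        also have "\<dots> \<le> 2 powr (real j * (- 1))"
          using r(3) by (intro powr_mono mult_left_mono) auto
        also have "\<dots> = (1 / 2) ^ j" by (simp add: powr_minus powr_realpow power_one_over inverse_eq_divide)
        finally show "a j * (G j * (2 * (8 * real ?N) ^ ?q * (16 / h j) ^ ?N)) \<le> C * (1/2) ^ j"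
          using C by (simp add: mult_left_mono)
      qed
      finally show ?thesis .
    qed
    have "(\<integral>\<^sup>+\<omega>. S \<omega> \<partial>M) = (\<Sum>j. ennreal (a j) * (\<integral>\<^sup>+\<omega>. chain_bound (h j) ?q (\<lambda>z. block U j z \<omega>) \<partial>M))"
      unfolding S_def by (simp add: nn_integral_suminf nn_integral_cmult)
    also have "\<dots> \<le> (\<Sum>j. ennreal (C * (1/2) ^ j))" by (intro suminf_le level) auto
    also have "\<dots> = ennreal (C * 2)"
      using C sums_mult[OF geometric_sums[of "1/2::real"], of C] by (intro suminf_ennreal_eq) auto
    also have "\<dots> < \<infinity>" by simp
    finally show "(\<integral>\<^sup>+\<omega>. S \<omega> \<partial>M) < \<infinity>" .
  next
    fix j \<omega> and z :: "'n ph" assume \<omega>: "\<omega> \<in> space M"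
    let ?X = "\<lambda>z. block U j z \<omega>"
    have cont: "continuous_on UNIV ?X"
      using noise \<omega> schwartz_lp_check[of j] unfolding gaussian_noise_def block_def by blast
    have "(2 powr (real j * \<beta>) * rho \<kappa> z * \<bar>?X z\<bar>) ^ ?q = 2 powr (real j * \<beta> * real ?q) * (rho \<kappa> z ^ ?q * \<bar>?X z\<bar> ^ ?q)"
      unfolding power_mult_distrib mult.assoc by (subst powr_power) (simp_all add: mult_ac)
    also have "\<dots> \<le> 2 powr (real j * \<beta> * real ?q) * (2 ^ ?N * poly_weight z * \<bar>?X z\<bar> ^ ?q)"
      by (intro mult_left_mono mult_right_mono rho_power_le k r(2)) auto
    also have "\<dots> = a j * (poly_weight z * \<bar>?X z\<bar> ^ ?q)" by (simp only: a_def mult_ac)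
    finally have "ennreal ((2 powr (real j * \<beta>) * rho \<kappa> z * \<bar>?X z\<bar>) ^ ?q) \<le> ennreal (a j) * ennreal (poly_weight z * \<bar>?X z\<bar> ^ ?q)"
      by (subst ennreal_mult'[symmetric]) (auto simp: a_def intro!: ennreal_leI)
    also have "\<dots> \<le> ennreal (a j) * chain_bound (h j) ?q ?X"
      using r(1) by (intro mult_left_mono weighted_power_le_chain_bound h cont) auto
    also have "\<dots> \<le> S \<omega>"
      unfolding S_def using sum_le_suminf[of "\<lambda>j. ennreal (a j) * chain_bound (h j) ?q (\<lambda>z. block U j z \<omega>)" "{j}"] by simp
    finally show "ennreal ((2 powr (real j * \<beta>) * rho \<kappa> z * \<bar>U (translate z (lp_check chi j)) \<omega>\<bar>) ^ ?q) \<le> S \<omega>"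
      by (simp add: block_def)
  qed
qed

text \<open>As \<open>enn2real\<close> sends infinity to 0, integrability alone would not exclude an
  infinite norm; the almost sure finiteness is therefore a separate conjunct.\<close>

theorem mainTheorem16:
  fixes chi0 :: "('n::finite) ph \<Rightarrow> real"
    and mup mun :: "'n ph measure"
    and M :: "'w measure"
    and U :: "('n ph \<Rightarrow> real) \<Rightarrow> 'w \<Rightarrow> real"
    and ell p \<kappa> \<beta> :: real
  assumes d2: "CARD('n) \<ge> 2"
    and chi_smooth: "smooth_fun chi0"
    and chi_sym: "\<And>\<xi>. chi0 (- \<xi>) = chi0 \<xi>"
    and chi_one: "\<And>\<xi>. anorm \<xi> \<le> 1 \<Longrightarrow> chi0 \<xi> = 1"
    and chi_zero: "\<And>\<xi>. anorm \<xi> > 4/3 \<Longrightarrow> chi0 \<xi> = 0"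
    and A: "condA ell mup mun"
    and noise: "gaussian_noise M mup mun U"
    and p: "1 \<le> p"
    and kappa: "\<kappa> > 3 * real CARD('n) / p"
    and beta: "\<beta> < ell / 2 - 4 * real CARD('n) / p"
  shows "(AE \<omega> in M. Cnorm chi0 \<beta> \<kappa> U \<omega> \<noteq> \<infinity>) \<and>
         integrable M (\<lambda>\<omega>. enn2real (Cnorm chi0 \<beta> \<kappa> U \<omega>) powr p)"
proof -
  interpret lp_cutoff chi0
    by standard (use chi_smooth chi_sym chi_one chi_zero in auto)
  let ?N = "real DIM('n ph)"
  have k0: "\<kappa> > 0" using kappa p by (elim order.strict_trans1[rotated]) simp
  have "0 \<le> 4 * real CARD('n) / p" using p by simp
  then have b0: "ell / 2 - \<beta> > 0" using beta by linarith
  have N0: "?N \<ge> 0" by simp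
  \<comment> \<open>Four lower bounds for r, added because all are nonnegative: the first three give
    the conditions of \<open>weighted_moment_dominated\<close>, the last gives p <= 2r.\<close>
  define x where "x = (?N + 1) + 3 * ?N / \<kappa> + (3 * ?N + 1) / (ell / 2 - \<beta>) + p"
  obtain r :: nat where r: "x \<le> real r" using real_arch_simple by blast
  have x: "?N + 1 \<le> x" "3 * ?N / \<kappa> \<le> x" "(3 * ?N + 1) / (ell / 2 - \<beta>) \<le> x" "p \<le> x"
    using N0 k0 b0 p divide_nonneg_pos[of "3 * ?N" \<kappa>] divide_nonneg_pos[of "3 * ?N + 1" "ell / 2 - \<beta>"]
    unfolding x_def by linarith+
  let ?q = "2 * r"
  have r1: "2 * DIM('n ph) + 2 \<le> 2 * r" using x(1) r by linarith
  have "3 * ?N / \<kappa> \<le> real r" using x(2) r by linarith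
  then have r2: "6 * ?N \<le> \<kappa> * real ?q" using k0 by (simp add: divide_le_eq mult_ac)
  have "(3 * ?N + 1) / (ell / 2 - \<beta>) \<le> real ?q" using x(3) r by simp
  then have r3: "3 * ?N + 1 \<le> (ell / 2 - \<beta>) * real ?q" using b0 by (simp only: divide_le_eq if_True mult.commute)
  have r4: "p \<le> real ?q" using x(4) r by simp
  obtain S where Sm[measurable]: "S \<in> borel_measurable M" and Sfin: "(\<integral>\<^sup>+\<omega>. S \<omega> \<partial>M) < \<infinity>"
    and S: "\<And>j z \<omega>. \<omega> \<in> space M \<Longrightarrow>
      ennreal ((2 powr (real j * \<beta>) * rho \<kappa> z * \<bar>U (translate z (lp_check chi0 j)) \<omega>\<bar>) ^ ?q) \<le> S \<omega>"
    using weighted_moment_dominated[OF A noise less_imp_le[OF k0] r1 r2 r3] by metis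
  have sch: "schwartz (translate z (lp_check chi0 j))" for z j
    by (rule schwartz_translate[OF schwartz_lp_check])
  have Cm[measurable]: "Cnorm chi0 \<beta> \<kappa> U \<in> borel_measurable M"
  proof (rule borel_measurable_Cnorm)
    show "U (translate z (lp_check chi0 j)) \<in> borel_measurable M" for j z
      using noise sch[of z j] unfolding gaussian_noise_def centered_gaussian_def by blast
    show "continuous_on UNIV (\<lambda>z. U (translate z (lp_check chi0 j)) \<omega>)" if "\<omega> \<in> space M" for j \<omega>
      using noise that schwartz_lp_check[of j] unfolding gaussian_noise_def by blast
  qed
  \<comment> \<open>S bounds the q-th powers uniformly in j and z, so its q-th root bounds the
    double supremum.\<close>
  have root: "Cnorm chi0 \<beta> \<kappa> U \<omega> \<le> ennreal (root ?q (enn2real (S \<omega>)))" if \<omega>: "\<omega> \<in> space M" "S \<omega> < \<infinity>" for \<omega>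
    unfolding Cnorm_def
  proof (intro SUP_least ennreal_leI)
    fix j z
    let ?y = "2 powr (real j * \<beta>) * rho \<kappa> z * \<bar>U (translate z (lp_check chi0 j)) \<omega>\<bar>"
    have y0: "0 \<le> ?y" by (simp add: rho_def)
    have "ennreal (?y ^ ?q) \<le> ennreal (enn2real (S \<omega>))" using S[OF \<omega>(1)] \<omega>(2) by simp
    then have "?y ^ ?q \<le> enn2real (S \<omega>)" by (subst (asm) ennreal_le_iff) auto
    then have "root ?q (?y ^ ?q) \<le> root ?q (enn2real (S \<omega>))" using r1 by (intro real_root_le_mono) auto
    then show "?y \<le> root ?q (enn2real (S \<omega>))" using y0 r1 by (subst (asm) real_root_power_cancel) auto
  qed
  have SAE: "AE \<omega> in M. S \<omega> < \<infinity>"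
    using nn_integral_noteq_infinite[OF Sm] Sfin by (simp add: less_top)
  have "AE \<omega> in M. Cnorm chi0 \<beta> \<kappa> U \<omega> \<noteq> \<infinity>"
    using SAE AE_space
  proof eventually_elim
    case (elim \<omega>)
    then show ?case using root[of \<omega>] by (auto simp: top_unique)
  qed
  moreover have "integrable M (\<lambda>\<omega>. enn2real (Cnorm chi0 \<beta> \<kappa> U \<omega>) powr p)"
  proof (rule Bochner_Integration.integrable_bound)
    interpret prob_space M using noise by (simp add: gaussian_noise_def)
    have "(\<integral>\<^sup>+\<omega>. ennreal (enn2real (S \<omega>)) \<partial>M) = (\<integral>\<^sup>+\<omega>. S \<omega> \<partial>M)"
      using SAE by (intro nn_integral_cong_AE) (auto elim: eventually_mono)
    then have "integrable M (\<lambda>\<omega>. enn2real (S \<omega>))"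
      using Sfin by (intro integrableI_nonneg) auto
    \<comment> \<open>The majorant of the p-th power: y^p <= 1 if y <= 1, and y^p <= y^q otherwise.
      The constant is integrable because M is a probability space.\<close>
    then show "integrable M (\<lambda>\<omega>. 1 + enn2real (S \<omega>))" by simp
    show "AE \<omega> in M. norm (enn2real (Cnorm chi0 \<beta> \<kappa> U \<omega>) powr p) \<le> norm (1 + enn2real (S \<omega>))"
      using SAE AE_space
    proof eventually_elim
      case (elim \<omega>)
      define s where "s = enn2real (S \<omega>)"
      define y where "y = root ?q s"
      have s: "s \<ge> 0" by (simp add: s_def)
      have y: "y \<ge> 0" "y ^ ?q = s" using s r1 by (auto simp: y_def)
      have "enn2real (Cnorm chi0 \<beta> \<kappa> U \<omega>) \<le> y"
        using root[of \<omega>] elim y(1) by (intro enn2real_leI) (auto simp: y_def s_def)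
      then have "enn2real (Cnorm chi0 \<beta> \<kappa> U \<omega>) powr p \<le> y powr p"
        using p by (intro powr_mono2) auto
      also have "\<dots> \<le> 1 + s"
      proof (cases "y \<le> 1")
        case True
        then have "y powr p \<le> 1 powr p" using y p by (intro powr_mono2) auto
        then show ?thesis using s by simp
      next
        case False
        then have "y powr p \<le> y powr real ?q" using r4 by (intro powr_mono) auto
        also have "\<dots> = s" using False y by (subst powr_realpow) auto
        finally show ?thesis by simp
      qed
      finally show ?case using s by (simp add: s_def)
    qed
  qed measurable
  ultimately show ?thesis by blast
qed

end
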